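(* With the harmonic sums $\mathrm{H}_w$ ($w\in Y^*$, $Y=\{y_k\}_{k\ge1}$) and their extension $\mathrm{H}_S$ to series $S$ as in the context: for every $r\ge1$ and every $t\in\mathbb{C}$ with $|t|<1$, $$\mathrm{H}_{(t^ry_r)^*}=\sum_{k\ge0}\mathrm{H}_{y_r^k}t^{kr}=\exp\biggl(-\sum_{k\ge1}\mathrm{H}_{y_{kr}}\frac{(-t^r)^{k}}{k}\biggr).$$ Moreover, for complex families $(a_s)_{s\ge1},(b_s)_{s\ge1}$ with $|a_s|<1$, $|b_s|<1$ and $|a_s+b_s|<1$ (the series involved being in $\mathrm{Dom}(\mathrm{H}_\bullet)$), $$\mathrm{H}_{(\sum_{s\ge1}(a_s+b_s)y_s+\sum_{r,s\ge1}a_sb_ry_{s+r})^*}=\mathrm{H}_{(\sum_{s\ge1}a_sy_s)^*}\,\mathrm{H}_{(\sum_{s\ge1}b_sy_s)^*}.$$ Hence (for $r,s\ge1$), $$\mathrm{H}_{(a_sy_s+a_ry_r+a_sa_ry_{s+r})^*}=\mathrm{H}_{(a_sy_s)^*}\mathrm{H}_{(a_ry_r)^*},\qquad \mathrm{H}_{(-a_s^2y_{2s})^*}=\mathrm{H}_{(a_sy_s)^*}\mathrm{H}_{(-a_sy_s)^*}.$$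
   Context: For $w=y_{s_1}\cdots y_{s_m}\in Y^*$, $\mathrm{H}_w:\mathbb{N}\to\mathbb{Q}$ is the arithmetic function $\mathrm{H}_w(n)=\sum_{n\ge n_1>\cdots>n_m>0}n_1^{-s_1}\cdots n_m^{-s_m}$ (and $\mathrm{H}_{1_{Y^*}}=1$); identities between arithmetic functions are pointwise. $S^*=\sum_{n\ge0}S^n$ (concatenation powers) is the Kleene star of a series with zero constant term. Extension to series: let $X=\{x_0,x_1\}$, let $\pi_X$ be the concatenation morphism $y_s\mapsto x_0^{s-1}x_1$, and let $\pi_Y$ be its adjoint, which sends $x_0^{s_1-1}x_1\cdots x_0^{s_m-1}x_1$ back to $y_{s_1}\cdots y_{s_m}$. For such a word set $\mathrm{Li}_{x_0^{s_1-1}x_1\cdots x_0^{s_m-1}x_1}(z)=\sum_{n_1>\cdots>n_m>0}z^{n_1}n_1^{-s_1}\cdots n_m^{-s_m}$ for $|z|<1$, and $\mathrm{Li}_{1_{X^*}}=1$, extended linearly. For $T\in\mathbb{C}1_{X^*}\oplus\mathbb{C}\langle\langle X\rangle\rangle x_1$ write $T=\sum_nT_n$ with $T_n=\sum_{|w|=n}\langle T|w\rangle w$. Then $S\in\mathrm{Dom}(\mathrm{H}_\bullet)$ iff $S=\pi_YT$ for such a $T$ with $\sum_n\mathrm{Li}_{T_n}$ converging (uniformly on compact subsets) in some disc $|z|<R$, $0<R\le1$; in that case $\mathrm{H}_S(N)$ is the coefficient of $z^N$ in $(1-z)^{-1}\mathrm{Li}_T(z)$, $\mathrm{Li}_T=\sum_n\mathrm{Li}_{T_n}$.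 *)

theory Defs
  imports "HOL-Complex_Analysis.Complex_Analysis"
begin

text \<open>
  A series over an alphabet is its coefficient function on words; the value at \<open>w\<close> is
  \<open>\<langle>S|w\<rangle>\<close>.
\<close>

type_synonym 'a ncseries = "'a list \<Rightarrow> complex"

definition letter :: "'a \<Rightarrow> 'a ncseries" where
  "letter x w = (if w = [x] then 1 else 0)"

definition nc_one :: "'a ncseries" where
  "nc_one w = (if w = [] then 1 else 0)"

definition nc_mult :: "'a ncseries \<Rightarrow> 'a ncseries \<Rightarrow> 'a ncseries" where
  "nc_mult S T w = (\<Sum>i\<le>length w. S (take i w) * T (drop i w))"

primrec nc_power :: "'a ncseries \<Rightarrow> nat \<Rightarrow> 'a ncseries" where
  "nc_power S 0 = nc_one"
| "nc_power S (Suc n) = nc_mult S (nc_power S n)"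

text \<open>
  Only meant for \<open>S\<close> with zero constant term; then \<open>nc_power S n w = 0\<close> for
  \<open>n > length w\<close>, so the sum below is finite for each \<open>w\<close>.
\<close>

definition kleene_star :: "'a ncseries \<Rightarrow> 'a ncseries" where
  "kleene_star S w = (\<Sum>n. nc_power S n w)"

text \<open>
  The letter \<open>y\<^sub>s\<close> is represented by the number \<open>s \<ge> 1\<close>. Since \<open>0\<close> is not a letter, the
  words over \<open>Y\<close> are the lists in \<open>Y_words\<close>, and series over \<open>Y\<close> vanish on all other lists.
\<close>

definition Y_words :: "nat list set" where
  "Y_words = {ss. \<forall>s\<in>set ss. 1 \<le> s}"

datatype X = x0 | x1

definition pi_X :: "nat list \<Rightarrow> X list" where
  "pi_X ss = concat (map (\<lambda>s. replicate (s - 1) x0 @ [x1]) ss)"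

text \<open>The adjoint of \<open>pi_X\<close>: \<open>\<langle>\<pi>\<^sub>Y T|w\<rangle> = \<langle>T|\<pi>\<^sub>X w\<rangle>\<close> for every word \<open>w\<close> over \<open>Y\<close>.\<close>

definition pi_Y :: "X ncseries \<Rightarrow> nat ncseries" where
  "pi_Y T w = (if w \<in> Y_words then T (pi_X w) else 0)"

text \<open>The space \<open>\<complex>1 \<oplus> \<complex>\<langle>\<langle>X\<rangle>\<rangle>x\<^sub>1\<close>.\<close>

definition X_admissible :: "X ncseries set" where
  "X_admissible = {T. \<forall>w. T w \<noteq> 0 \<longrightarrow> w = [] \<or> last w = x1}"

text \<open>
  The summation indices \<open>n\<^sub>1 > \<dots> > n\<^sub>m > 0\<close> form the list \<open>ns\<close>. The empty word has the
  single index list \<open>[]\<close> and the value \<open>1\<close>.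
\<close>

definition H_word :: "nat list \<Rightarrow> nat \<Rightarrow> complex" where
  "H_word ss n =
     (\<Sum>ns | length ns = length ss \<and> sorted_wrt (>) ns \<and> set ns \<subseteq> {1..n}.
        \<Prod>i<length ss. 1 / of_nat (ns ! i) ^ (ss ! i))"

definition Li_Y_word :: "nat list \<Rightarrow> complex \<Rightarrow> complex" where
  "Li_Y_word ss z =
     (if ss = [] then 1
      else (\<Sum>\<^sub>\<infinity>ns\<in>{ns. length ns = length ss \<and> sorted_wrt (>) ns \<and> set ns \<subseteq> {1..}}.
              z ^ hd ns * (\<Prod>i<length ss. 1 / of_nat (ns ! i) ^ (ss ! i))))"

text \<open>
  \<open>pi_X\<close> is injective on \<open>Y_words\<close>, with image the empty word and the words ending in \<open>x1\<close>.
  Other words carry coefficient zero in every series to which \<open>Li_word\<close> is extended below.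
\<close>

definition Li_word :: "X list \<Rightarrow> complex \<Rightarrow> complex" where
  "Li_word w = Li_Y_word (inv_into Y_words pi_X w)"

text \<open>\<open>Li_hom T n\<close> is \<open>Li\<close> of the homogeneous component \<open>T\<^sub>n\<close>.\<close>

definition Li_hom :: "X ncseries \<Rightarrow> nat \<Rightarrow> complex \<Rightarrow> complex" where
  "Li_hom T n z = (\<Sum>w | length w = n. T w * Li_word w z)"

definition Li_series :: "X ncseries \<Rightarrow> complex \<Rightarrow> complex" where
  "Li_series T z = (\<Sum>n. Li_hom T n z)"

definition Dom_H :: "nat ncseries set" where
  "Dom_H = {S. \<exists>T\<in>X_admissible. S = pi_Y T \<and>
     (\<exists>R. 0 < R \<and> R \<le> 1 \<and>
       (\<forall>K. compact K \<and> K \<subseteq> ball 0 R \<longrightarrow>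
          uniformly_convergent_on K (\<lambda>m z. \<Sum>n<m. Li_hom T n z)))}"

text \<open>
  \<open>pi_Y\<close> is injective on \<open>X_admissible\<close>, so the description of \<open>T\<close> is definite for \<open>S \<in> Dom_H\<close>.
  Outside of \<open>Dom_H\<close> the value of \<open>H_series\<close> is meaningless.
\<close>

definition H_series :: "nat ncseries \<Rightarrow> nat \<Rightarrow> complex" where
  "H_series S N =
     (let T = (THE T. T \<in> X_admissible \<and> S = pi_Y T)
      in fps_nth (fps_expansion (\<lambda>z. inverse (1 - z) * Li_series T z) 0) N)"

end

theory Submission
  imports Defs
begin

text \<open>
  For a linear form with coefficients \<open>c\<close>, the coefficient of a word in the Kleene star is the product
  of the coefficients of its letters. Locally uniform convergence passes to Taylor coefficients, so
  the value of H at \<open>N\<close> is the value at \<open>u = 1\<close> of the power series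
  \<open>\<Prod>j=1..N. (1 + (\<Sum>s\<ge>1. c s * (u / j) ^ s))\<close>. The product formula is therefore an identity of
  formal power series, and Abel's limit theorem transports it to \<open>u = 1\<close>, where the three series
  converge but perhaps only conditionally. For a single letter the product is
  \<open>\<Prod>j=1..N. (1 + t ^ r / j ^ r)\<close>, whose logarithm is expanded factor by factor.
\<close>

subsection \<open>Abel's theorem and Cauchy products\<close>

text \<open>Membership in \<open>Dom_H\<close> controls only the series of weight components. It
  does not license a rearrangement of the words, so the variable \<open>u\<close> has to record
  exactly the grading by weight, and products have to be Cauchy products in the weight. The letters
  y_{s+r} in the third series are the cross terms of (1 + A(u)) (1 + B(u)), where A and B are the
  generating series of the two families. A Cauchy product of two conditionally convergent series can
  diverge; this is why the general formula takes membership of all three series in the domain as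
  given. For one and two letters membership is proved, from a majorant that is geometric in N. The
  condition |t| < 1 is what makes the logarithm series converge: the largest of the quotients |t^r /
  j^r| is the one with j = 1.\<close>

lemma abel_limit:
  fixes f :: "nat \<Rightarrow> complex"
  assumes f: "f sums s"
  shows "((\<lambda>x::real. \<Sum>n. f n * of_real x ^ n) \<longlongrightarrow> s) (at_left 1)"
proof -
  define d where "d n = (\<Sum>i\<le>n. f i) - s" for n
  have d0: "d \<longlonglongrightarrow> 0"
    using f unfolding d_def sums_def_le by (simp add: LIM_zero)
  then obtain M where M: "\<And>n. norm (d n) \<le> M"
    using Bseq_def convergentI convergent_imp_Bseq by metis
  have M0: "M \<ge> 0" using M[of 0] norm_ge_zero order_trans by blast
  \<comment> \<open>Summation by parts in disguise: dividing a power series by 1 - x replaces its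
    coefficients by their partial sums. Subtracting s times the geometric series leaves the
    deviations \<open>d n\<close>, which are small for large n.\<close>
  have key: "(\<lambda>n. (1 - of_real x) * (d n * of_real x ^ n)) sums ((\<Sum>n. f n * of_real x ^ n) - s)"
    if x: "0 < x" "x < 1" for x :: real
  proof -
    have sf: "summable (\<lambda>n. norm (f n * of_real x ^ n))"
      using powser_insidea[of f 1 "of_real x"] f x by (simp add: sums_iff)
    have sx: "summable (\<lambda>n. norm ((of_real x :: complex) ^ n))"
      using x by (simp add: norm_power summable_geometric)
    have gx: "(\<lambda>n. (of_real x :: complex) ^ n) sums (1 / (1 - of_real x))"
      using x by (intro geometric_sums) auto
    have x1: "(1 - of_real x :: complex) \<noteq> 0" using x by auto
    have "(\<lambda>n. \<Sum>i\<le>n. f i * of_real x ^ i * of_real x ^ (n - i)) sums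
        ((\<Sum>n. f n * of_real x ^ n) * (1 / (1 - of_real x)))"
      using Cauchy_product_sums[OF sf sx] gx by (simp add: sums_iff)
    also have "(\<lambda>n. \<Sum>i\<le>n. f i * of_real x ^ i * of_real x ^ (n - i)) =
       (\<lambda>n. (\<Sum>i\<le>n. f i) * (of_real x :: complex) ^ n)"
      by (rule ext, unfold sum_distrib_right, rule sum.cong)
         (auto simp: mult.assoc simp flip: power_add)
    finally have "(\<lambda>n. (\<Sum>i\<le>n. f i) * (of_real x :: complex) ^ n - s * of_real x ^ n) sums
        ((\<Sum>n. f n * of_real x ^ n) * (1 / (1 - of_real x)) - s * (1 / (1 - of_real x)))"
      by (intro sums_diff sums_mult gx)
    then have "(\<lambda>n. (1 - of_real x) * ((\<Sum>i\<le>n. f i) * of_real x ^ n - s * of_real x ^ n)) sums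
        ((1 - of_real x) * ((\<Sum>n. f n * of_real x ^ n) * (1 / (1 - of_real x)) - s * (1 / (1 - of_real x))))"
      by (rule sums_mult)
    moreover have "y * (F * (1 / y) - s * (1 / y)) = F - s" if "y \<noteq> 0" for y F :: complex
      using that by (simp add: right_diff_distrib)
    note this[OF x1]
    ultimately show ?thesis
      by (simp only: d_def left_diff_distrib)
  qed
  have "((\<lambda>x::real. (\<Sum>n. f n * of_real x ^ n) - s) \<longlongrightarrow> 0) (at_left 1)"
  proof (rule tendstoI)
    fix e :: real assume e: "e > 0"
    then obtain n0 where n0: "\<And>n. n \<ge> n0 \<Longrightarrow> norm (d n) < e / 2"
      using d0 unfolding LIMSEQ_iff by (metis diff_zero half_gt_zero)
    have "((\<lambda>x::real. (1 - x) * (M * n0)) \<longlongrightarrow> (1 - 1) * (M * n0)) (at_left 1)"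
      by (intro tendsto_intros)
    then have "eventually (\<lambda>x::real. (1 - x) * (M * n0) < e / 2) (at_left 1)"
      using e by (intro order_tendstoD(2)) auto
    moreover have "eventually (\<lambda>x::real. 0 < x \<and> x < 1) (at_left 1)"
      using eventually_at_left_real[of 0 1] by simp
    ultimately show "eventually (\<lambda>x::real. dist ((\<Sum>n. f n * of_real x ^ n) - s) 0 < e) (at_left 1)"
    proof eventually_elim
      case (elim x)
      \<comment> \<open>The majorant splits at \<open>n0\<close>. The head sums to (1 - x) M n0,
        which vanishes as x tends to 1; the tail sums to exactly e / 2 for every x, because the
        factor 1 - x cancels the geometric series.\<close>
      define g where "g n = (1 - x) * ((if n < n0 then M else 0) + e / 2 * x ^ n)" for n
      have "(\<lambda>n. if n < n0 then M else 0) sums (\<Sum>n<n0. M)"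
        using sums_If_finite_set[of "{..<n0}" "\<lambda>_. M"] by simp
      then have g: "g sums ((1 - x) * ((\<Sum>n<n0. M) + e / 2 * (1 / (1 - x))))"
        unfolding g_def using elim by (intro sums_mult sums_add geometric_sums) auto
      have le: "norm ((1 - of_real x) * (d n * of_real x ^ n)) \<le> g n" for n
      proof -
        have nx: "norm (1 - complex_of_real x) = 1 - x"
          using elim norm_of_real[of "1 - x", where 'a = complex] by simp
        have "norm (d n) * x ^ n \<le> (if n < n0 then M else 0) + e / 2 * x ^ n"
        proof (cases "n < n0")
          case True
          have "norm (d n) * x ^ n \<le> M * 1"
            using elim M[of n] M0 by (intro mult_mono power_le_one) auto
          then show ?thesis using True e elim by (simp add: add_increasing2)
        next
          case False
          then show ?thesis using n0[of n] elim by (simp add: mult_right_mono)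
        qed
        then show ?thesis
          using elim by (simp add: norm_mult norm_power nx g_def mult_left_mono)
      qed
      have "norm (\<Sum>n. (1 - of_real x) * (d n * of_real x ^ n)) \<le> suminf g"
        by (intro norm_suminf_le le) (use g in \<open>auto simp: sums_iff\<close>)
      also have "suminf g = (1 - x) * (\<Sum>n<n0. M) + (1 - x) * (e / 2 * (1 / (1 - x)))"
        using sums_unique[OF g] by (simp only: distrib_left)
      also have "(1 - x) * (e / 2 * (1 / (1 - x))) = e / 2"
        using elim by (metis diff_gt_0_iff_gt less_irrefl mult.left_commute mult.right_neutral nonzero_mult_div_cancel_left times_divide_eq_right)
      also have "(1 - x) * (\<Sum>n<n0. M) = (1 - x) * (M * n0)"
        by simp
      also have "(1 - x) * (M * n0) + e / 2 < e" using elim by linarith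
      finally show ?case using key[of x] elim by (simp add: sums_iff)
    qed
  qed
  then show ?thesis by (simp add: LIM_zero_cancel)
qed

text \<open>For 0 < x < 1 all series converge absolutely, so the usual product theorem applies
  there, and both sides have a limit as x tends to 1. Convergence of the product series is a
  hypothesis because it does not follow from that of the factors.\<close>

lemma Cauchy_product_sums_unique:
  fixes f g :: "nat \<Rightarrow> complex"
  assumes f: "f sums s" and g: "g sums t" and fg: "(\<lambda>n. \<Sum>i\<le>n. f i * g (n - i)) sums u"
  shows "u = s * t"
proof -
  have ab: "summable (\<lambda>n. norm (h n * (of_real x :: complex) ^ n))"
    if "h sums v" "0 < x" "x < 1" for h v and x :: real
    using powser_insidea[of h 1 "of_real x"] that by (simp add: sums_iff)
  have "eventually (\<lambda>x::real. 0 < x \<and> x < 1) (at_left 1)"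
    using eventually_at_left_real[of 0 1] by simp
  then have "eventually (\<lambda>x::real. (\<Sum>n. f n * of_real x ^ n) * (\<Sum>n. g n * of_real x ^ n) =
      (\<Sum>n. (\<Sum>i\<le>n. f i * g (n - i)) * of_real x ^ n)) (at_left 1)"
  proof eventually_elim
    case (elim x)
    have "(\<Sum>n. f n * of_real x ^ n) * (\<Sum>n. g n * of_real x ^ n) =
        (\<Sum>n. \<Sum>i\<le>n. f i * of_real x ^ i * (g (n - i) * of_real x ^ (n - i)))"
      using elim by (intro Cauchy_product ab[OF f] ab[OF g]) auto
    also have "\<dots> = (\<Sum>n. (\<Sum>i\<le>n. f i * g (n - i)) * of_real x ^ n)"
      unfolding sum_distrib_right
      by (intro suminf_cong sum.cong refl) (simp add: mult_ac flip: power_add)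
    finally show ?case .
  qed
  moreover have "((\<lambda>x::real. (\<Sum>n. f n * of_real x ^ n) * (\<Sum>n. g n * of_real x ^ n)) \<longlongrightarrow> s * t) (at_left 1)"
    by (intro tendsto_mult abel_limit f g)
  ultimately have "((\<lambda>x::real. \<Sum>n. (\<Sum>i\<le>n. f i * g (n - i)) * of_real x ^ n) \<longlongrightarrow> s * t) (at_left 1)"
    using tendsto_cong by fastforce
  with abel_limit[OF fg] show ?thesis
    using tendsto_unique trivial_limit_at_left_real by blast
qed

subsection \<open>Kleene stars of linear forms\<close>

text \<open>Common shape of all the series whose stars occur. The value \<open>c 0\<close> belongs
  to no letter of Y, so it must be 0 whenever the star is to live on \<open>Y_words\<close>.\<close>

definition linear_form :: "(nat \<Rightarrow> complex) \<Rightarrow> nat ncseries" where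
  "linear_form c w = (case w of [s] \<Rightarrow> c s | _ \<Rightarrow> 0)"

lemma nc_mult_linear_form_Nil: "nc_mult (linear_form c) T [] = 0"
  by (simp add: nc_mult_def linear_form_def)

text \<open>Of all ways to cut the word, only the cut after the first letter leaves a left factor of
  length one.\<close>

lemma nc_mult_linear_form_Cons: "nc_mult (linear_form c) T (x # w) = c x * T w"
proof -
  have "nc_mult (linear_form c) T (x # w) =
      (\<Sum>i\<in>{1}. linear_form c (take i (x # w)) * T (drop i (x # w)))"
    unfolding nc_mult_def
  proof (rule sum.mono_neutral_right)
    show "\<forall>i\<in>{..length (x # w)} - {1}. linear_form c (take i (x # w)) * T (drop i (x # w)) = 0"
    proof
      fix i assume i: "i \<in> {..length (x # w)} - {1}"
      then have "length (take i (x # w)) \<noteq> 1" by auto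
      then have "linear_form c (take i (x # w)) = 0"
        unfolding linear_form_def by (cases "take i (x # w)" rule: list.exhaust) (auto split: list.splits)
      then show "linear_form c (take i (x # w)) * T (drop i (x # w)) = 0" by simp
    qed
  qed auto
  then show ?thesis by (simp add: linear_form_def)
qed

lemma nc_power_linear_form:
  "nc_power (linear_form c) n w = (if length w = n then prod_list (map c w) else 0)"
proof (induction n arbitrary: w)
  case 0
  then show ?case by (simp add: nc_one_def)
next
  case (Suc n)
  then show ?case
    by (cases w) (simp_all add: nc_mult_linear_form_Nil nc_mult_linear_form_Cons)
qed

lemma kleene_star_linear_form: "kleene_star (linear_form c) w = prod_list (map c w)"
proof -
  have "(\<lambda>n. nc_power (linear_form c) n w) = (\<lambda>n. if n = length w then prod_list (map c w) else 0)"
    by (auto simp: nc_power_linear_form)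
  then show ?thesis
    unfolding kleene_star_def
    using sums_single[of "length w" "\<lambda>_. prod_list (map c w)"] by (simp add: sums_iff)
qed

subsection \<open>Harmonic sums as partial sums of polylogarithm coefficients\<close>

definition index_lists :: "nat \<Rightarrow> nat \<Rightarrow> nat list set" where
  "index_lists m n = {ns. length ns = m \<and> sorted_wrt (>) ns \<and> set ns \<subseteq> {1..n}}"

definition summand :: "nat list \<Rightarrow> nat list \<Rightarrow> complex" where
  "summand ss ns = (\<Prod>i<length ss. 1 / of_nat (ns ! i) ^ (ss ! i))"

lemma H_word_index_lists: "H_word ss n = sum (summand ss) (index_lists (length ss) n)"
  by (simp add: H_word_def index_lists_def summand_def)

lemma finite_index_lists [simp]: "finite (index_lists m n)"
  by (rule finite_subset[OF _ finite_lists_length_eq[of "{1..n}" m]]) (auto simp: index_lists_def)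

lemma summand_Cons: "summand (s # ss) (k # ns) = 1 / of_nat k ^ s * summand ss ns"
  unfolding summand_def length_Cons prod.lessThan_Suc_shift by simp

lemma index_lists_0 [simp]: "index_lists 0 n = {[]}"
  by (auto simp: index_lists_def)

lemma index_lists_Suc:
  "index_lists (Suc m) n = (\<lambda>(k, ns). k # ns) ` Sigma {1..n} (\<lambda>k. index_lists m (k - 1))"
proof (intro equalityI subsetI)
  fix ns assume "ns \<in> index_lists (Suc m) n"
  then obtain k ns' where "ns = k # ns'" "length ns' = m" "sorted_wrt (>) ns'" "\<forall>x\<in>set ns'. x < k"
      "k \<in> {1..n}" "set ns' \<subseteq> {1..n}"
    by (auto simp: index_lists_def length_Suc_conv)
  then show "ns \<in> (\<lambda>(k, ns). k # ns) ` Sigma {1..n} (\<lambda>k. index_lists m (k - 1))"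
    by (force simp: index_lists_def)
next
  fix ns assume "ns \<in> (\<lambda>(k, ns). k # ns) ` Sigma {1..n} (\<lambda>k. index_lists m (k - 1))"
  then show "ns \<in> index_lists (Suc m) n"
    by (fastforce simp: index_lists_def)
qed

lemma inj_on_Cons_pair: "inj_on (\<lambda>(k, ns). k # ns) A"
  by (auto simp: inj_on_def)

lemma H_word_Nil [simp]: "H_word [] n = 1"
  by (simp add: H_word_index_lists summand_def)

lemma H_word_Cons: "H_word (s # ss) n = (\<Sum>k=1..n. 1 / of_nat k ^ s * H_word ss (k - 1))"
  unfolding H_word_index_lists length_Cons index_lists_Suc
  by (subst sum.reindex[OF inj_on_Cons_pair])
     (simp add: sum.Sigma o_def split_beta summand_Cons sum_distrib_left)

lemma H_word_Cons_0 [simp]: "H_word (s # ss) 0 = 0"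
  by (simp add: H_word_Cons)

lemma H_word_Cons_Suc:
  "H_word (s # ss) (Suc n) = H_word (s # ss) n + 1 / of_nat (Suc n) ^ s * H_word ss n"
  by (simp add: H_word_Cons)

text \<open>The coefficient of \<open>z ^ N\<close> in \<open>Li_Y_word ss z\<close>.\<close>

definition Li_coeff :: "nat list \<Rightarrow> nat \<Rightarrow> complex" where
  "Li_coeff ss N = (case ss of [] \<Rightarrow> (if N = 0 then 1 else 0)
     | s # ss' \<Rightarrow> (if N = 0 then 0 else 1 / of_nat N ^ s * H_word ss' (N - 1)))"

text \<open>Multiplication by 1/(1 - z) forms partial sums of coefficients: grouping the index lists
  by their largest index k turns the coefficients of the polylogarithm into the harmonic
  sum.\<close>

lemma sum_Li_coeff: "(\<Sum>k\<le>N. Li_coeff ss k) = H_word ss N"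
proof (cases ss)
  case Nil
  then show ?thesis by (simp add: Li_coeff_def)
next
  case (Cons s ss')
  show ?thesis unfolding Cons
    by (induction N) (simp_all add: H_word_Cons_Suc, simp_all add: Li_coeff_def)
qed

lemma Y_words_Nil [simp]: "[] \<in> Y_words"
  by (simp add: Y_words_def)

lemma Y_words_Cons [simp]: "s # ss \<in> Y_words \<longleftrightarrow> 1 \<le> s \<and> ss \<in> Y_words"
  by (simp add: Y_words_def)

text \<open>A crude linear bound suffices. In the induction the factor 1/k^s with s \<ge> 1 absorbs
  the bound k for the inner sum at k - 1, so every summand is at most 1.\<close>

lemma norm_H_word_le: "ss \<in> Y_words \<Longrightarrow> norm (H_word ss n) \<le> real n + 1"
proof (induction ss arbitrary: n)
  case Nil
  then show ?case by simp
next
  case (Cons s ss)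
  have "norm (H_word (s # ss) n) \<le> (\<Sum>k=1..n. norm (1 / of_nat k ^ s * H_word ss (k - 1)))"
    unfolding H_word_Cons by (rule norm_sum)
  also have "\<dots> \<le> (\<Sum>k=1..n. 1)"
  proof (rule sum_mono)
    fix k assume k: "k \<in> {1..n}"
    have "real k ^ 1 \<le> real k ^ s"
      using k Cons.prems by (intro power_increasing) auto
    moreover have "norm (H_word ss (k - 1)) \<le> real k"
      using Cons.IH[of "k - 1"] Cons.prems k by simp
    ultimately have "norm (H_word ss (k - 1)) \<le> real k ^ s" by (metis order_trans power_one_right)
    then show "norm (1 / of_nat k ^ s * H_word ss (k - 1)) \<le> 1"
      using k by (simp add: norm_mult norm_divide norm_power)
  qed
  finally show ?case by simp
qed

lemma norm_Li_coeff_le: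
  assumes "ss \<in> Y_words"
  shows "norm (Li_coeff ss N) \<le> 1"
proof (cases ss)
  case Nil
  then show ?thesis by (simp add: Li_coeff_def)
next
  case (Cons s ss')
  show ?thesis
  proof (cases "N = 0")
    case True
    then show ?thesis by (simp add: Cons Li_coeff_def)
  next
    case False
    have "real N ^ 1 \<le> real N ^ s"
      using False assms Cons by (intro power_increasing) auto
    moreover have "norm (H_word ss' (N - 1)) \<le> real N"
      using norm_H_word_le[of ss' "N - 1"] assms Cons False by simp
    ultimately have "norm (H_word ss' (N - 1)) \<le> real N ^ s" by (metis order_trans power_one_right)
    then show ?thesis using False
      by (simp add: Cons Li_coeff_def norm_mult norm_divide norm_power)
  qed
qed

section \<open>Power series of the polylogarithms in the unit disc\<close>

lemma summable_Li_coeff: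
  assumes "ss \<in> Y_words" "norm z < 1"
  shows "summable (\<lambda>N. norm (Li_coeff ss N * z ^ N))"
proof (rule summable_comparison_test')
  show "summable (\<lambda>N. norm z ^ N)" using assms by simp
  show "norm (norm (Li_coeff ss N * z ^ N)) \<le> norm z ^ N" for N
    using norm_Li_coeff_le[OF assms(1)] by (simp add: norm_mult norm_power mult_left_le_one_le)
qed

lemma summand_eq_of_real: "summand ss ns = of_real (norm (summand ss ns))"
  unfolding summand_def by (simp add: prod_norm[symmetric] norm_divide norm_power)

text \<open>All summands are nonnegative reals, so no cancellation occurs. Absolute summability over
  index lists thereby reduces to that of a single power series.\<close>

lemma norm_H_word: "norm (H_word ss n) = (\<Sum>ns\<in>index_lists (length ss) n. norm (summand ss ns))"
proof -
  have "H_word ss n = of_real (\<Sum>ns\<in>index_lists (length ss) n. norm (summand ss ns))"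
    unfolding H_word_index_lists of_real_sum using summand_eq_of_real by (intro sum.cong) auto
  moreover have "(\<Sum>ns\<in>index_lists (length ss) n. norm (summand ss ns)) \<ge> 0"
    by (intro sum_nonneg) auto
  ultimately show ?thesis by (simp only: norm_of_real abs_of_nonneg)
qed

text \<open>The defining sum is unordered over all index lists. It is absolutely summable for |z| <
  1, hence may be grouped by the largest index k, which is the exponent of z; for each k only
  finitely many lists remain.\<close>

lemma Li_Y_word_sums:
  assumes ss: "ss \<in> Y_words" and z: "norm z < 1"
  shows "(\<lambda>N. Li_coeff ss N * z ^ N) sums Li_Y_word ss z"
proof (cases ss)
  case Nil
  have "(\<lambda>N. Li_coeff [] N * z ^ N) = (\<lambda>N. if N = 0 then 1 else 0)"
    by (auto simp: Li_coeff_def)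
  then show ?thesis
    using sums_single[of 0 "\<lambda>_. 1 :: complex"] by (simp add: Nil Li_Y_word_def eq_commute)
next
  case (Cons s ss')
  define m where "m = length ss'"
  define I where "I = {ns :: nat list. length ns = Suc m \<and> sorted_wrt (>) ns \<and> set ns \<subseteq> {1..}}"
  define F where "F = (\<lambda>(k, ns). z ^ k * summand ss (k # ns))"
  have "I = (\<Union>n. index_lists (Suc m) n)"
  proof (intro equalityI subsetI)
    fix ns assume ns: "ns \<in> I"
    have "set ns \<subseteq> {1..Max (insert 0 (set ns))}"
      using ns by (auto simp: I_def)
    then show "ns \<in> (\<Union>n. index_lists (Suc m) n)"
      using ns unfolding I_def index_lists_def by blast
  qed (auto simp: I_def index_lists_def)
  also have "\<dots> = (\<lambda>(k, ns). k # ns) ` Sigma {1..} (\<lambda>k. index_lists m (k - 1))"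
    unfolding index_lists_Suc by force
  finally have I: "I = (\<lambda>(k, ns). k # ns) ` Sigma {1..} (\<lambda>k. index_lists m (k - 1))" .
  have Li: "Li_Y_word ss z = infsum F (Sigma {1..} (\<lambda>k. index_lists m (k - 1)))"
  proof -
    have "Li_Y_word ss z = (\<Sum>\<^sub>\<infinity>ns\<in>I. z ^ hd ns * summand ss ns)"
      unfolding Li_Y_word_def summand_def I_def m_def using Cons by simp
    also have "\<dots> = infsum F (Sigma {1..} (\<lambda>k. index_lists m (k - 1)))"
      unfolding I infsum_reindex[OF inj_on_Cons_pair]
      by (rule infsum_cong) (auto simp: F_def)
    finally show ?thesis .
  qed
  have inner: "(\<Sum>ns\<in>index_lists m (k - 1). F (k, ns)) = Li_coeff ss k * z ^ k" if "k \<ge> 1" for k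
    using that by (simp add: F_def Cons summand_Cons Li_coeff_def H_word_index_lists m_def
       sum_distrib_left sum_distrib_right mult_ac)
  have inner_norm: "(\<Sum>ns\<in>index_lists m (k - 1). norm (F (k, ns))) = norm (Li_coeff ss k * z ^ k)"
    if "k \<ge> 1" for k
    using that by (simp add: F_def Cons summand_Cons Li_coeff_def norm_H_word m_def norm_mult
       norm_power norm_divide sum_distrib_left sum_distrib_right sum_divide_distrib mult_ac)
  have abs: "(\<lambda>k. norm (Li_coeff ss k * z ^ k)) summable_on {1..}"
    by (rule summable_on_subset_banach[of _ UNIV])
       (use summable_Li_coeff[OF assms] in \<open>auto simp: summable_on_UNIV_nonneg_real_iff\<close>)
  have "(\<lambda>x. norm (F x)) summable_on Sigma {1..} (\<lambda>k. index_lists m (k - 1))"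
    unfolding Infinite_Sum.abs_summable_on_Sigma_iff
  proof (intro conjI ballI)
    show "(\<lambda>ns. norm (F (k, ns))) summable_on index_lists m (k - 1)" for k by simp
    show "(\<lambda>k. norm (\<Sum>\<^sub>\<infinity>ns\<in>index_lists m (k - 1). norm (F (k, ns)))) summable_on {1..}"
      using abs by (subst summable_on_cong[where g = "\<lambda>k. norm (Li_coeff ss k * z ^ k)"])
        (simp_all add: inner_norm del: One_nat_def)
  qed
  then have sF: "F summable_on Sigma {1..} (\<lambda>k. index_lists m (k - 1))"
    using Infinite_Sum.abs_summable_summable by blast
  have "infsum F (Sigma {1..} (\<lambda>k. index_lists m (k - 1))) =
      (\<Sum>\<^sub>\<infinity>k\<in>{1..}. \<Sum>\<^sub>\<infinity>ns\<in>index_lists m (k - 1). F (k, ns))"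
    using infsum_Sigma_banach[OF sF] by simp
  also have "\<dots> = (\<Sum>\<^sub>\<infinity>k\<in>{1..}. Li_coeff ss k * z ^ k)"
    by (rule infsum_cong) (simp add: inner del: One_nat_def)
  also have "\<dots> = (\<Sum>\<^sub>\<infinity>k. Li_coeff ss k * z ^ k)"
    by (rule infsum_cong_neutral) (auto simp: Cons Li_coeff_def not_le)
  finally have "Li_Y_word ss z = (\<Sum>\<^sub>\<infinity>k. Li_coeff ss k * z ^ k)" using Li by simp
  moreover have "(\<lambda>k. Li_coeff ss k * z ^ k) sums (\<Sum>k. Li_coeff ss k * z ^ k)"
    using summable_norm_cancel[OF summable_Li_coeff[OF assms]] by (rule summable_sums)
  ultimately show ?thesis
    using norm_summable_imp_has_sum[OF summable_Li_coeff[OF assms]] infsumI by metis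
qed

subsection \<open>The encoding of words over Y by words over X\<close>

lemma pi_X_Nil [simp]: "pi_X [] = []"
  by (simp add: pi_X_def)

lemma pi_X_Cons: "pi_X (s # ss) = replicate (s - 1) x0 @ x1 # pi_X ss"
  by (simp add: pi_X_def)

lemma length_pi_X: "ss \<in> Y_words \<Longrightarrow> length (pi_X ss) = sum_list ss"
  by (induction ss) (auto simp: pi_X_Cons)

lemma replicate_x0_x1_eq_iff:
  "replicate a x0 @ x1 # u = replicate b x0 @ x1 # v \<longleftrightarrow> a = b \<and> u = v"
proof (induction a arbitrary: b)
  case 0
  then show ?case by (cases b) auto
next
  case (Suc a)
  then show ?case by (cases b) auto
qed

text \<open>Each block ends at its only \<open>x1\<close>, so the code is uniquely decodable. The
  restriction to \<open>Y_words\<close> matters: with truncated subtraction the entries 0 and 1 have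
  the same block.\<close>

lemma inj_on_pi_X: "inj_on pi_X Y_words"
proof (rule inj_onI)
  show "ss = ss'" if "ss \<in> Y_words" "ss' \<in> Y_words" "pi_X ss = pi_X ss'" for ss ss'
    using that
  proof (induction ss arbitrary: ss')
    case Nil
    then show ?case by (cases ss') (auto simp: pi_X_Cons)
  next
    case (Cons s ss)
    then show ?case by (cases ss') (auto simp: pi_X_Cons replicate_x0_x1_eq_iff)
  qed
qed

lemma pi_X_image: "w \<in> pi_X ` Y_words \<longleftrightarrow> w = [] \<or> last w = x1"
proof
  assume "w \<in> pi_X ` Y_words"
  then obtain ss where "ss \<in> Y_words" "w = pi_X ss" by auto
  moreover have "pi_X ss = [] \<or> last (pi_X ss) = x1" for ss
    by (induction ss) (auto simp: pi_X_Cons)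
  ultimately show "w = [] \<or> last w = x1" by simp
next
  assume "w = [] \<or> last w = x1"
  then show "w \<in> pi_X ` Y_words"
  proof (induction w)
    case Nil
    then show ?case by (intro image_eqI[of _ _ "[]"]) auto
  next
    case (Cons x w)
    show ?case
    proof (cases "w = []")
      case True
      then show ?thesis using Cons.prems
        by (intro image_eqI[of _ _ "[1]"]) (auto simp: pi_X_Cons)
    next
      case False
      then obtain ss where ss: "ss \<in> Y_words" "w = pi_X ss" using Cons by auto
      show ?thesis
      proof (cases x)
        \<comment> \<open>Prefixing \<open>x0\<close> lengthens the first block, so it raises the
          first letter by one; prefixing \<open>x1\<close> opens a new block for the letter
          y_1.\<close>
        case x0
        obtain s ss' where "ss = Suc s # ss'"
          using False ss by (metis Y_words_Cons One_nat_def Suc_le_D neq_Nil_conv pi_X_Nil)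
        then show ?thesis using ss x0
          by (intro image_eqI[of _ _ "Suc (Suc s) # ss'"]) (auto simp: pi_X_Cons)
      next
        case x1
        then show ?thesis using ss
          by (intro image_eqI[of _ _ "1 # ss"]) (auto simp: pi_X_Cons)
      qed
    qed
  qed
qed

lemma pi_Y_inject:
  assumes "T \<in> X_admissible" "T' \<in> X_admissible" "pi_Y T = pi_Y T'"
  shows "T = T'"
proof
  fix w
  show "T w = T' w"
  proof (cases "w \<in> pi_X ` Y_words")
    case True
    then obtain ss where "ss \<in> Y_words" "w = pi_X ss" by auto
    then show ?thesis using fun_cong[OF assms(3), of ss] by (simp add: pi_Y_def)
  next
    case False
    then have "T w = 0" "T' w = 0"
      using assms(1,2) unfolding X_admissible_def pi_X_image by blast+
    then show ?thesis by simp
  qed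
qed

text \<open>The weight of a word over Y is the length of its image under \<open>pi_X\<close>, so
  these words index the homogeneous component of degree n.\<close>

definition weight_words :: "nat \<Rightarrow> nat list set" where
  "weight_words n = {ss \<in> Y_words. sum_list ss = n}"

lemma length_le_sum_list: "ss \<in> Y_words \<Longrightarrow> length ss \<le> sum_list ss"
  by (induction ss) auto

lemma finite_weight_words [simp]: "finite (weight_words n)"
proof (rule finite_subset)
  show "weight_words n \<subseteq> {ss. set ss \<subseteq> {..n} \<and> length ss \<le> n}"
    using length_le_sum_list by (auto simp: weight_words_def intro: member_le_sum_list)
qed (simp add: finite_lists_length_le)

lemma Li_hom_pi_Y:
  assumes T: "T \<in> X_admissible"
  shows "Li_hom T n z = (\<Sum>ss\<in>weight_words n. pi_Y T ss * Li_Y_word ss z)"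
proof -
  have "(UNIV :: X set) = {x0, x1}"
    using X.exhaust by auto
  then have "finite (UNIV :: X set)"
    by (metis finite.emptyI finite_insert)
  then have "finite {w :: X list. length w = n}"
    using finite_lists_length_eq[of "UNIV :: X set" n] by simp
  then have "Li_hom T n z = (\<Sum>w\<in>pi_X ` weight_words n. T w * Li_word w z)"
    unfolding Li_hom_def
  proof (rule sum.mono_neutral_right)
    show "pi_X ` weight_words n \<subseteq> {w. length w = n}"
      by (auto simp: weight_words_def length_pi_X)
    show "\<forall>w\<in>{w. length w = n} - pi_X ` weight_words n. T w * Li_word w z = 0"
    proof
      fix w assume w: "w \<in> {w. length w = n} - pi_X ` weight_words n"
      then have "w \<notin> pi_X ` Y_words"
        by (auto simp: weight_words_def length_pi_X image_iff)
      then show "T w * Li_word w z = 0"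
        using T by (auto simp: X_admissible_def pi_X_image)
    qed
  qed
  also have "\<dots> = (\<Sum>ss\<in>weight_words n. T (pi_X ss) * Li_word (pi_X ss) z)"
    by (subst sum.reindex) (auto intro: inj_on_subset[OF inj_on_pi_X] simp: weight_words_def)
  also have "\<dots> = (\<Sum>ss\<in>weight_words n. pi_Y T ss * Li_Y_word ss z)"
    by (intro sum.cong refl)
       (auto simp: weight_words_def pi_Y_def Li_word_def inv_into_f_f[OF inj_on_pi_X])
  finally show ?thesis .
qed

subsection \<open>Evaluation of H on its domain\<close>

lemma Li_hom_sums:
  assumes T: "T \<in> X_admissible" and z: "norm z < 1"
  shows "(\<lambda>N. (\<Sum>ss\<in>weight_words n. pi_Y T ss * Li_coeff ss N) * z ^ N) sums Li_hom T n z"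
proof -
  have "(\<lambda>N. \<Sum>ss\<in>weight_words n. pi_Y T ss * (Li_coeff ss N * z ^ N)) sums Li_hom T n z"
    unfolding Li_hom_pi_Y[OF T]
    by (intro sums_sum sums_mult Li_Y_word_sums z) (simp add: weight_words_def)
  then show ?thesis by (simp add: sum_distrib_right mult.assoc)
qed

lemma holomorphic_Li_hom:
  assumes "T \<in> X_admissible"
  shows "Li_hom T n holomorphic_on ball 0 1"
  by (rule power_series_holomorphic) (use Li_hom_sums[OF assms] in auto)

lemma has_fps_expansion_Li_hom:
  assumes "T \<in> X_admissible"
  shows "Li_hom T n has_fps_expansion Abs_fps (\<lambda>N. \<Sum>ss\<in>weight_words n. pi_Y T ss * Li_coeff ss N)"
proof (rule has_fps_expansionI)
  have "eventually (\<lambda>z::complex. z \<in> ball 0 1) (nhds 0)"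
    by (intro eventually_nhds_in_open) auto
  then show "eventually (\<lambda>z. (\<lambda>N. fps_nth (Abs_fps (\<lambda>N. \<Sum>ss\<in>weight_words n. pi_Y T ss * Li_coeff ss N)) N * z ^ N)
      sums Li_hom T n z) (nhds 0)"
    by eventually_elim (use Li_hom_sums[OF assms] in auto)
qed

lemma has_fps_expansion_inverse_one_minus:
  "(\<lambda>z::complex. inverse (1 - z)) has_fps_expansion Abs_fps (\<lambda>_. 1)"
proof (rule has_fps_expansionI)
  have "eventually (\<lambda>z::complex. z \<in> ball 0 1) (nhds 0)"
    by (intro eventually_nhds_in_open) auto
  then show "eventually (\<lambda>z::complex. (\<lambda>N. fps_nth (Abs_fps (\<lambda>_. 1)) N * z ^ N)
      sums inverse (1 - z)) (nhds 0)"
    by eventually_elim (use geometric_sums in \<open>auto simp: inverse_eq_divide\<close>)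
qed

text \<open>
  Only the sum over all weights \<open>n\<close> of the weight-\<open>n\<close> parts below is known to converge, possibly
  conditionally; a summation over all words need not make sense.
\<close>

definition graded_H :: "nat ncseries \<Rightarrow> nat \<Rightarrow> nat \<Rightarrow> complex" where
  "graded_H S N n = (\<Sum>ss\<in>weight_words n. S ss * H_word ss N)"

theorem H_series_sums:
  assumes "S \<in> Dom_H"
  shows "graded_H S N sums H_series S N"
proof -
  obtain T R where T: "T \<in> X_admissible" and S: "S = pi_Y T" and R: "0 < R" "R \<le> 1"
    and conv: "\<And>K. compact K \<Longrightarrow> K \<subseteq> ball 0 R \<Longrightarrow>
          uniformly_convergent_on K (\<lambda>m z. \<Sum>n<m. Li_hom T n z)"
    using assms unfolding Dom_H_def by blast
  define P where "P = (\<lambda>m z. \<Sum>n<m. Li_hom T n z)"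
  have the_T: "(THE T'. T' \<in> X_admissible \<and> S = pi_Y T') = T"
    using T S pi_Y_inject by (intro the_equality) auto
  \<comment> \<open>One compact disc is enough: its interior is a neighbourhood of 0, and Taylor
    coefficients at 0 see nothing more.\<close>
  have "uniformly_convergent_on (cball 0 (R/2)) P"
    unfolding P_def by (rule conv) (use R in auto)
  then have lim: "uniform_limit (cball 0 (R/2)) P (Li_series T) sequentially"
    unfolding uniformly_convergent_uniform_limit_iff P_def Li_series_def suminf_eq_lim .
  have holP: "P m holomorphic_on ball 0 1" for m
    unfolding P_def by (intro holomorphic_intros holomorphic_Li_hom T)
  have subs: "cball 0 (R/2) \<subseteq> ball (0::complex) 1" "ball 0 (R/2) \<subseteq> ball (0::complex) 1"
    using R by auto
  have "continuous_on (cball 0 (R/2)) (P m) \<and> P m holomorphic_on ball 0 (R/2)" for m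
    using holP subs by (meson holomorphic_on_imp_continuous_on holomorphic_on_subset)
  then have hol: "Li_series T holomorphic_on ball 0 (R/2)"
    using holomorphic_uniform_limit[OF always_eventually lim] by auto
  define F where "F = fps_expansion (Li_series T) 0"
  have F: "Li_series T has_fps_expansion F"
    unfolding F_def by (rule has_fps_expansion_fps_expansion[OF _ _ hol]) (use R in auto)
  have coeff: "(\<lambda>n. \<Sum>ss\<in>weight_words n. S ss * Li_coeff ss k) sums fps_nth F k" for k
  proof -
    have "uniform_limit (ball 0 (R/2)) P (Li_series T) sequentially"
      by (rule uniform_limit_on_subset[OF lim]) auto
    then have "(\<lambda>m. (deriv ^^ k) (P m) 0) \<longlonglongrightarrow> (deriv ^^ k) (Li_series T) 0"
      by (rule higher_deriv_complex_uniform_limit)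
         (use R holomorphic_on_subset[OF holP subs(2)] in auto)
    then have "(\<lambda>m. (deriv ^^ k) (P m) 0 / fact k) \<longlonglongrightarrow> (deriv ^^ k) (Li_series T) 0 / fact k"
      by (intro tendsto_intros) auto
    moreover have "(deriv ^^ k) (P m) 0 / fact k = (\<Sum>n<m. \<Sum>ss\<in>weight_words n. S ss * Li_coeff ss k)" for m
    proof -
      have "P m has_fps_expansion (\<Sum>n<m. Abs_fps (\<lambda>N. \<Sum>ss\<in>weight_words n. pi_Y T ss * Li_coeff ss N))"
        unfolding P_def by (intro has_fps_expansion_sum has_fps_expansion_Li_hom T)
      from fps_nth_fps_expansion[OF this, of k] show ?thesis
        by (simp add: fps_sum_nth S)
    qed
    ultimately show ?thesis
      using fps_nth_fps_expansion[OF F, of k] by (simp add: sums_def)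
  qed
  have "(\<lambda>z. inverse (1 - z) * Li_series T z) has_fps_expansion Abs_fps (\<lambda>_. 1) * F"
    by (intro has_fps_expansion_mult has_fps_expansion_inverse_one_minus F)
  then have "H_series S N = fps_nth (F * Abs_fps (\<lambda>_. 1)) N"
    unfolding H_series_def the_T Let_def by (simp add: fps_expansion_eqI mult.commute)
  then have H: "H_series S N = (\<Sum>k\<le>N. fps_nth F k)"
    by (simp add: fps_mult_nth atLeast0AtMost)
  \<comment> \<open>Only the finitely many coefficients with k \<le> N enter, so this sum commutes
    with the series over the weights without any absolute convergence.\<close>
  have "(\<lambda>n. \<Sum>k\<le>N. \<Sum>ss\<in>weight_words n. S ss * Li_coeff ss k) sums H_series S N"
    unfolding H by (intro sums_sum coeff)
  moreover have "(\<Sum>k\<le>N. \<Sum>ss\<in>weight_words n. S ss * Li_coeff ss k) = graded_H S N n" for n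
    unfolding graded_H_def sum_Li_coeff[symmetric] sum_distrib_left by (rule sum.swap)
  ultimately show ?thesis by simp
qed

subsection \<open>Products of Kleene stars\<close>

lemma weight_words_0: "weight_words 0 = {[]}"
proof -
  have "ss = []" if "ss \<in> Y_words" "sum_list ss = 0" for ss
    using length_le_sum_list[OF that(1)] that(2) by simp
  then show ?thesis by (auto simp: weight_words_def)
qed

lemma weight_words_pos:
  assumes "n > 0"
  shows "weight_words n = (\<lambda>(s, ss). s # ss) ` Sigma {1..n} (\<lambda>s. weight_words (n - s))"
proof (intro equalityI subsetI)
  fix w assume w: "w \<in> weight_words n"
  then obtain s ss where "w = s # ss"
    using assms by (cases w) (auto simp: weight_words_def)
  then show "w \<in> (\<lambda>(s, ss). s # ss) ` Sigma {1..n} (\<lambda>s. weight_words (n - s))"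
    using w by (auto simp: weight_words_def image_iff)
next
  fix w assume "w \<in> (\<lambda>(s, ss). s # ss) ` Sigma {1..n} (\<lambda>s. weight_words (n - s))"
  then obtain s ss where "w = s # ss" "1 \<le> s" "s \<le> n" "ss \<in> Y_words" "sum_list ss = n - s"
    unfolding weight_words_def by fastforce
  then show "w \<in> weight_words n"
    by (simp add: weight_words_def)
qed

lemma sum_weight_words_pos:
  assumes "n > 0"
  shows "(\<Sum>w\<in>weight_words n. f w) = (\<Sum>s=1..n. \<Sum>ss\<in>weight_words (n - s). f (s # ss))"
  unfolding weight_words_pos[OF assms]
  by (subst sum.reindex[OF inj_on_Cons_pair]) (simp add: sum.Sigma split_beta o_def)

abbreviation star_form :: "(nat \<Rightarrow> complex) \<Rightarrow> nat ncseries" where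
  "star_form c \<equiv> kleene_star (linear_form c)"

lemma graded_H_0: "graded_H (star_form c) 0 n = (if n = 0 then 1 else 0)"
proof (cases "n = 0")
  case True
  then show ?thesis by (simp add: graded_H_def weight_words_0 kleene_star_linear_form)
next
  case False
  then show ?thesis by (simp add: graded_H_def sum_weight_words_pos)
qed

text \<open>In an index list bounded by N + 1, either the largest index is N + 1, and its letter y_i
  contributes \<open>c i\<close> / (N + 1)^i and leaves weight n - i, or all indices are at most N.
  The second case is the term i = 0, for which the entry at 0 is set to 1.\<close>

lemma graded_H_Suc:
  "graded_H (star_form c) (Suc N) n =
     (\<Sum>i\<le>n. (c(0 := 1)) i / of_nat (Suc N) ^ i * graded_H (star_form c) N (n - i))"
proof (cases "n = 0")
  case True
  then show ?thesis by (simp add: graded_H_def weight_words_0 kleene_star_linear_form)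
next
  case False
  have "graded_H (star_form c) (Suc N) n = graded_H (star_form c) N n +
      (\<Sum>i=1..n. c i / of_nat (Suc N) ^ i * graded_H (star_form c) N (n - i))"
    using False unfolding graded_H_def
    by (simp add: sum_weight_words_pos kleene_star_linear_form H_word_Cons_Suc distrib_left
       sum.distrib sum_distrib_left mult.assoc mult.left_commute del: of_nat_Suc)
  also have "(\<Sum>i=1..n. c i / of_nat (Suc N) ^ i * graded_H (star_form c) N (n - i)) =
     (\<Sum>i=1..n. (c(0 := 1)) i / of_nat (Suc N) ^ i * graded_H (star_form c) N (n - i))"
    by (intro sum.cong) auto
  finally show ?thesis
    unfolding atMost_atLeast0 sum.atLeast_Suc_atMost[OF le0] One_nat_def by simp
qed

lemma Abs_fps_graded_H_Suc:
  "Abs_fps (graded_H (star_form c) (Suc N)) =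
     Abs_fps (\<lambda>i. (c(0 := 1)) i / of_nat (Suc N) ^ i) * Abs_fps (graded_H (star_form c) N)"
  by (rule fps_ext) (simp only: fps_nth_Abs_fps fps_mult_nth atLeast0AtMost graded_H_Suc)

text \<open>
  Marking the weight by a variable \<open>u\<close> gives \<open>\<Prod>j=1..N. (1 + (\<Sum>s\<ge>1. c s * (u / j) ^ s))\<close>, so a
  factorisation of \<open>1 + (\<Sum>s\<ge>1. c s * u ^ s)\<close> is inherited at every level \<open>N\<close>.
\<close>

lemma Abs_fps_graded_H_mult:
  assumes "Abs_fps (c(0 := 1)) = Abs_fps (a(0 := 1)) * Abs_fps (b(0 := 1))"
  shows "Abs_fps (graded_H (star_form c) N) =
    Abs_fps (graded_H (star_form a) N) * Abs_fps (graded_H (star_form b) N)"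
proof (induction N)
  case 0
  have "Abs_fps (graded_H (star_form c) 0) = 1" for c
    by (rule fps_ext) (simp only: fps_nth_Abs_fps graded_H_0 fps_one_nth)
  then show ?case by simp
next
  case (Suc N)
  let ?scale = "\<lambda>c. Abs_fps (\<lambda>i. (c(0 := 1)) i / of_nat (Suc N) ^ i :: complex)"
  \<comment> \<open>Substituting u / (N + 1) for u is multiplicative: the denominators of degrees i
    and n - i combine to that of degree n.\<close>
  have "?scale c = ?scale a * ?scale b"
  proof (rule fps_ext)
    fix n
    have "(c(0 := 1)) n = (\<Sum>i=0..n. (a(0 := 1)) i * (b(0 := 1)) (n - i))"
      using arg_cong[OF assms, of "\<lambda>f. fps_nth f n"] by (simp only: fps_mult_nth fps_nth_Abs_fps)
    then show "fps_nth (?scale c) n = fps_nth (?scale a * ?scale b) n"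
      unfolding fps_mult_nth fps_nth_Abs_fps
      by (simp only: sum_divide_distrib, intro sum.cong refl)
         (simp flip: power_add del: of_nat_Suc fun_upd_apply)
  qed
  then show ?case
    by (simp only: Abs_fps_graded_H_Suc Suc.IH mult_ac)
qed

theorem H_series_star_mult:
  assumes "star_form a \<in> Dom_H" "star_form b \<in> Dom_H" "star_form c \<in> Dom_H"
    and "Abs_fps (c(0 := 1)) = Abs_fps (a(0 := 1)) * Abs_fps (b(0 := 1))"
  shows "H_series (star_form c) N = H_series (star_form a) N * H_series (star_form b) N"
proof (rule Cauchy_product_sums_unique)
  have "graded_H (star_form c) N n =
      (\<Sum>i\<le>n. graded_H (star_form a) N i * graded_H (star_form b) N (n - i))" for n
    using arg_cong[OF Abs_fps_graded_H_mult[OF assms(4)], of "\<lambda>f. fps_nth f n"]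
    by (simp only: fps_nth_Abs_fps fps_mult_nth atLeast0AtMost)
  then have "graded_H (star_form c) N =
      (\<lambda>n. \<Sum>i\<le>n. graded_H (star_form a) N i * graded_H (star_form b) N (n - i))" ..
  then show "(\<lambda>n. \<Sum>i\<le>n. graded_H (star_form a) N i * graded_H (star_form b) N (n - i)) sums
      H_series (star_form c) N"
    using H_series_sums[OF assms(3), of N] by (simp only:)
qed (intro H_series_sums assms)+

subsection \<open>Membership in the domain\<close>

definition light_words :: "nat \<Rightarrow> nat list set" where
  "light_words m = (\<Union>n<m. weight_words n)"

lemma finite_light_words [simp]: "finite (light_words m)"
  by (simp add: light_words_def)

lemma sum_light_words: "(\<Sum>ss\<in>light_words m. f ss) = (\<Sum>n<m. \<Sum>ss\<in>weight_words n. f ss)"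
  unfolding light_words_def by (rule sum.UNION_disjoint, simp, simp, auto simp: weight_words_def)

text \<open>Removing the first letter of a word of weight below m leaves such a word, and the letter
  is at most m. The pairs on the right also produce heavier words, which is harmless for nonnegative
  terms.\<close>

lemma sum_light_words_le:
  fixes f :: "nat list \<Rightarrow> real"
  assumes "\<And>ss. f ss \<ge> 0"
  shows "(\<Sum>ss\<in>light_words m. f ss) \<le> f [] + (\<Sum>s=1..m. \<Sum>ss\<in>light_words m. f (s # ss))"
proof -
  let ?A = "(\<lambda>(s, ss). s # ss) ` ({1..m} \<times> light_words m)"
  have "light_words m \<subseteq> insert [] ?A"
  proof
    fix w assume w: "w \<in> light_words m"
    show "w \<in> insert [] ?A"
    proof (cases w)
      case (Cons s ss)
      then have "s \<in> {1..m}" "ss \<in> light_words m"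
        using w by (auto simp: light_words_def weight_words_def)
      then show ?thesis using Cons by auto
    qed simp
  qed
  then have "(\<Sum>ss\<in>light_words m. f ss) \<le> (\<Sum>ss\<in>insert [] ?A. f ss)"
    by (intro sum_mono2 assms) auto
  also have "\<dots> = f [] + (\<Sum>ss\<in>?A. f ss)"
    by (rule sum.insert) auto
  also have "(\<Sum>ss\<in>?A. f ss) = (\<Sum>s=1..m. \<Sum>ss\<in>light_words m. f (s # ss))"
    by (subst sum.reindex[OF inj_on_Cons_pair]) (simp add: sum.cartesian_product split_beta o_def)
  finally show ?thesis .
qed

text \<open>
  The weighted sum of all harmonic sums at \<open>N\<close> is at most \<open>\<Prod>j=1..N. (1 + M / j)\<close>; the cruder bound
  \<open>(1 + M) ^ N\<close> is enough, because the disc in the definition of \<open>Dom_H\<close> may be small.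
\<close>

context
  fixes c :: "nat \<Rightarrow> complex" and M :: real
  assumes c: "\<And>m. (\<Sum>s=1..m. norm (c s)) \<le> M"
begin

lemma sum_norm_bound_nonneg: "M \<ge> 0"
  using c[of 0] by simp

text \<open>At a positive exponent the empty word contributes nothing. For a first letter y_s the
  coefficient is the harmonic sum of the rest at N over (N + 1)^s; dropping the denominator and
  summing over s yields the factor M.\<close>

lemma sum_norm_Li_coeff_Suc_le:
  "(\<Sum>ss\<in>light_words m. norm (star_form c ss) * norm (Li_coeff ss (Suc N))) \<le>
     M * (\<Sum>ss\<in>light_words m. norm (star_form c ss) * norm (H_word ss N))"
proof -
  have "(\<Sum>ss\<in>light_words m. norm (star_form c ss) * norm (Li_coeff ss (Suc N))) \<le>
      (\<Sum>s=1..m. \<Sum>ss\<in>light_words m. norm (star_form c (s # ss)) * norm (Li_coeff (s # ss) (Suc N)))"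
    using sum_light_words_le[of "\<lambda>ss. norm (star_form c ss) * norm (Li_coeff ss (Suc N))" m]
    by (simp add: Li_coeff_def)
  also have "\<dots> \<le> (\<Sum>s=1..m. \<Sum>ss\<in>light_words m. norm (c s) * (norm (star_form c ss) * norm (H_word ss N)))"
  proof (intro sum_mono)
    fix s ss
    have "1 \<le> real (Suc N) ^ s" by (rule one_le_power) simp
    then have "norm (H_word ss N) / real (Suc N) ^ s \<le> norm (H_word ss N) / 1"
      by (intro divide_left_mono) auto
    then have "norm (Li_coeff (s # ss) (Suc N)) \<le> norm (H_word ss N)"
      by (simp add: Li_coeff_def norm_mult norm_divide norm_power del: of_nat_Suc)
    then show "norm (star_form c (s # ss)) * norm (Li_coeff (s # ss) (Suc N)) \<le>
        norm (c s) * (norm (star_form c ss) * norm (H_word ss N))"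
      by (simp add: kleene_star_linear_form norm_mult mult.assoc mult_left_mono)
  qed
  also have "\<dots> = (\<Sum>s=1..m. norm (c s)) * (\<Sum>ss\<in>light_words m. norm (star_form c ss) * norm (H_word ss N))"
    by (simp add: sum_product)
  also have "\<dots> \<le> M * (\<Sum>ss\<in>light_words m. norm (star_form c ss) * norm (H_word ss N))"
    by (intro mult_right_mono c sum_nonneg) auto
  finally show ?thesis .
qed

text \<open>Passing from N to N + 1 adds the polylogarithm coefficients at N + 1, whose weighted sum
  is at most M times the previous one; hence a factor 1 + M per step.\<close>

lemma sum_norm_H_word_le:
  "(\<Sum>ss\<in>light_words m. norm (star_form c ss) * norm (H_word ss N)) \<le> (1 + M) ^ N"
proof (induction N)
  case 0
  show ?case
    using sum_light_words_le[of "\<lambda>ss. norm (star_form c ss) * norm (H_word ss 0)" m]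
    by (simp add: kleene_star_linear_form)
next
  case (Suc N)
  have H: "H_word ss (Suc N) = H_word ss N + Li_coeff ss (Suc N)" for ss
    by (simp flip: sum_Li_coeff)
  have "(\<Sum>ss\<in>light_words m. norm (star_form c ss) * norm (H_word ss (Suc N))) \<le>
    (\<Sum>ss\<in>light_words m. norm (star_form c ss) * norm (H_word ss N) +
       norm (star_form c ss) * norm (Li_coeff ss (Suc N)))"
    unfolding H by (intro sum_mono, unfold distrib_left[symmetric], intro mult_left_mono norm_triangle_ineq) auto
  also have "\<dots> \<le> (1 + M) * (\<Sum>ss\<in>light_words m. norm (star_form c ss) * norm (H_word ss N))"
    using sum_norm_Li_coeff_Suc_le[where m = m and N = N] by (simp add: sum.distrib distrib_right)
  also have "\<dots> \<le> (1 + M) * (1 + M) ^ N"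
    using sum_norm_bound_nonneg by (intro mult_left_mono Suc.IH) auto
  finally show ?case by simp
qed

lemma sum_norm_Li_coeff_le:
  "(\<Sum>ss\<in>light_words m. norm (star_form c ss) * norm (Li_coeff ss N)) \<le> (1 + M) ^ N"
proof (cases N)
  case 0
  show ?thesis
    using sum_light_words_le[of "\<lambda>ss. norm (star_form c ss) * norm (Li_coeff ss 0)" m] 0
    by (simp add: kleene_star_linear_form Li_coeff_def)
next
  case (Suc N')
  have "(\<Sum>ss\<in>light_words m. norm (star_form c ss) * norm (Li_coeff ss (Suc N'))) \<le> M * (1 + M) ^ N'"
    using sum_norm_Li_coeff_Suc_le[where m = m and N = N'] mult_left_mono[OF sum_norm_H_word_le[where m = m and N = N'] sum_norm_bound_nonneg]
    by linarith
  also have "\<dots> \<le> (1 + M) * (1 + M) ^ N'"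
    using sum_norm_bound_nonneg by (intro mult_right_mono) auto
  finally show ?thesis using Suc by simp
qed

theorem star_form_in_Dom_H:
  assumes "c 0 = 0"
  shows "star_form c \<in> Dom_H"
proof -
  define T where "T w = (if w \<in> pi_X ` Y_words then star_form c (inv_into Y_words pi_X w) else 0)" for w
  have T: "T \<in> X_admissible"
    by (auto simp: X_admissible_def T_def simp flip: pi_X_image)
  have S: "star_form c = pi_Y T"
  proof
    fix ss
    show "star_form c ss = pi_Y T ss"
    proof (cases "ss \<in> Y_words")
      case True
      then show ?thesis by (simp add: pi_Y_def T_def inv_into_f_f[OF inj_on_pi_X])
    next
      case False
      then have "0 \<in> set ss" by (auto simp: Y_words_def not_less_eq_eq)
      then have "prod_list (map c ss) = 0"
        using assms by (auto simp: prod_list_zero_iff image_iff)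
      then show ?thesis using False by (simp add: pi_Y_def kleene_star_linear_form)
    qed
  qed
  \<comment> \<open>Within this radius the bound (1 + M)^N for the coefficients of z^N gives a
    convergent geometric series.\<close>
  define R where "R = 1 / (1 + M)"
  have R: "0 < R" "R \<le> 1" using sum_norm_bound_nonneg by (auto simp: R_def)
  have "uniformly_convergent_on K (\<lambda>m z. \<Sum>n<m. Li_hom T n z)"
    if K: "compact K" "K \<subseteq> ball 0 R" for K
  proof -
    \<comment> \<open>Compactness keeps K at a positive distance from the circle of radius R: the
      norm attains its maximum on K, which needs K to be nonempty.\<close>
    obtain \<rho> where \<rho>: "0 \<le> \<rho>" "\<rho> < R" "\<And>z. z \<in> K \<Longrightarrow> norm z \<le> \<rho>"
    proof (cases "K = {}")
      case True
      then show ?thesis using that[of 0] R by auto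
    next
      case False
      then obtain z where "z \<in> K" "\<forall>y\<in>K. norm y \<le> norm z"
        using continuous_attains_sup[OF K(1), of norm] by (auto intro: continuous_intros)
      then show ?thesis using that[of "norm z"] K(2) by auto
    qed
    have \<rho>M: "0 \<le> \<rho> * (1 + M)" "\<rho> * (1 + M) < 1"
      using \<rho> sum_norm_bound_nonneg by (auto simp: R_def field_simps)
    \<comment> \<open>Majorant of the polylogarithm of one word, uniform over K.\<close>
    define A where "A ss = (\<Sum>N. norm (Li_coeff ss N * of_real \<rho> ^ N))" for ss
    have sA: "summable (\<lambda>N. norm (Li_coeff ss N * of_real \<rho> ^ N))" if "ss \<in> Y_words" for ss
      using \<rho> R by (intro summable_Li_coeff that) auto
    have A0: "A ss \<ge> 0" if "ss \<in> Y_words" for ss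
      unfolding A_def by (intro suminf_nonneg sA that) auto
    have Li_le: "norm (Li_Y_word ss z) \<le> A ss" if "ss \<in> Y_words" "z \<in> K" for ss z
    proof -
      have "norm z < 1" using \<rho>(2) \<rho>(3)[OF that(2)] R by linarith
      then have "Li_Y_word ss z = (\<Sum>N. Li_coeff ss N * z ^ N)"
        using Li_Y_word_sums[OF that(1)] by (simp add: sums_iff)
      also have "norm \<dots> \<le> A ss"
        unfolding A_def using \<rho>(3)[OF that(2)] \<rho>(1)
        by (intro norm_suminf_le sA that) (auto simp: norm_mult norm_power intro!: mult_left_mono power_mono)
      finally show ?thesis .
    qed
    define B where "B n = (\<Sum>ss\<in>weight_words n. norm (star_form c ss) * A ss)" for n
    show ?thesis
    proof (rule Weierstrass_m_test')
      show "norm (Li_hom T n z) \<le> B n" if "z \<in> K" for n z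
        unfolding Li_hom_pi_Y[OF T] B_def S[symmetric]
        by (intro order.trans[OF norm_sum] sum_mono)
           (auto simp: norm_mult weight_words_def intro!: mult_left_mono Li_le that)
      show "summable B"
      proof (rule summableI_nonneg_bounded)
        show "0 \<le> B n" for n
          unfolding B_def by (intro sum_nonneg mult_nonneg_nonneg A0) (auto simp: weight_words_def)
        show "sum B {..<m} \<le> 1 / (1 - \<rho> * (1 + M))" for m
        proof -
          have Y: "ss \<in> Y_words" if "ss \<in> light_words m" for ss
            using that by (auto simp: light_words_def weight_words_def)
          \<comment> \<open>The finite sum over words is exchanged with the series over N, since the
            bound (1 + M)^N holds for all words of weight below m together and is independent of
            m.\<close>
          have "sum B {..<m} = (\<Sum>ss\<in>light_words m. norm (star_form c ss) * A ss)"
            by (simp add: B_def sum_light_words)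
          also have "\<dots> = (\<Sum>ss\<in>light_words m. \<Sum>N. norm (star_form c ss) * norm (Li_coeff ss N * of_real \<rho> ^ N))"
            unfolding A_def by (intro sum.cong refl suminf_mult[symmetric] sA Y)
          also have "\<dots> = (\<Sum>N. \<Sum>ss\<in>light_words m. norm (star_form c ss) * norm (Li_coeff ss N * of_real \<rho> ^ N))"
            by (intro suminf_sum[symmetric] summable_mult sA Y)
          also have "\<dots> \<le> (\<Sum>N. (\<rho> * (1 + M)) ^ N)"
          proof (rule suminf_le)
            show "summable (\<lambda>N. (\<rho> * (1 + M)) ^ N)" using \<rho>M by (intro summable_geometric) auto
            show "summable (\<lambda>N. \<Sum>ss\<in>light_words m. norm (star_form c ss) * norm (Li_coeff ss N * of_real \<rho> ^ N))"
              by (intro summable_sum summable_mult sA Y)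
            show "(\<Sum>ss\<in>light_words m. norm (star_form c ss) * norm (Li_coeff ss N * of_real \<rho> ^ N))
                \<le> (\<rho> * (1 + M)) ^ N" for N
            proof -
              have "(\<Sum>ss\<in>light_words m. norm (star_form c ss) * norm (Li_coeff ss N * of_real \<rho> ^ N)) =
                  \<rho> ^ N * (\<Sum>ss\<in>light_words m. norm (star_form c ss) * norm (Li_coeff ss N))"
                using \<rho>(1) by (simp add: norm_mult norm_power sum_distrib_left mult_ac)
              also have "\<dots> \<le> \<rho> ^ N * (1 + M) ^ N"
                using \<rho>(1) by (intro mult_left_mono sum_norm_Li_coeff_le) auto
              finally show ?thesis by (simp add: power_mult_distrib)
            qed
          qed
          also have "\<dots> = 1 / (1 - \<rho> * (1 + M))"
            using \<rho>M by (intro suminf_geometric) auto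
          finally show ?thesis .
        qed
      qed
    qed
  qed
  then show ?thesis using T S R unfolding Dom_H_def by blast
qed

end

subsection \<open>Linear forms given by letters\<close>

definition single :: "nat \<Rightarrow> complex \<Rightarrow> nat \<Rightarrow> complex" where
  "single r x k = (if k = r then x else 0)"

lemma linear_form_single: "linear_form (single r x) = (\<lambda>w. x * letter r w)"
  by (auto simp: fun_eq_iff linear_form_def single_def letter_def split: list.splits)

lemma linear_form_add:
  "linear_form (\<lambda>k. c k + d k) = (\<lambda>w. linear_form c w + linear_form d w)"
  by (auto simp: fun_eq_iff linear_form_def split: list.splits)

text \<open>At a fixed word at most one term is nonzero, so the infinite sum exists for any
  coefficients. The range starts at 1, hence the value of \<open>a\<close> at 0 is erased.\<close>

lemma infsum_letter: "(\<Sum>\<^sub>\<infinity>s\<in>{1..}. a s * letter s w) = linear_form (a(0 := 0)) w"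
proof (cases "\<exists>k. w = [k]")
  case True
  then obtain k where w: "w = [k]" by auto
  have "(\<Sum>\<^sub>\<infinity>s\<in>{1..}. a s * letter s w) = (\<Sum>\<^sub>\<infinity>s\<in>{1..} \<inter> {k}. a s)"
    by (rule infsum_cong_neutral) (auto simp: w letter_def)
  then show ?thesis by (cases "k = 0") (auto simp: w linear_form_def)
next
  case False
  then have "letter s w = 0" for s by (auto simp: letter_def)
  then show ?thesis using False by (auto simp: linear_form_def split: list.splits)
qed

lemma infsum_letter_add:
  "(\<Sum>\<^sub>\<infinity>(r, s)\<in>{1..} \<times> {1..}. a s * b r * letter (s + r) w) =
     linear_form (\<lambda>k. \<Sum>i\<in>{1..<k}. a i * b (k - i)) w"
proof (cases "\<exists>k. w = [k]")
  case True
  then obtain k where w: "w = [k]" by auto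
  have "(\<Sum>\<^sub>\<infinity>(r, s)\<in>{1..} \<times> {1..}. a s * b r * letter (s + r) w) =
      (\<Sum>\<^sub>\<infinity>(r, s)\<in>(\<lambda>i. (k - i, i)) ` {1..<k}. a s * b r)"
    by (rule infsum_cong_neutral) (force simp: w letter_def image_iff)+
  also have "\<dots> = (\<Sum>(r, s)\<in>(\<lambda>i. (k - i, i)) ` {1..<k}. a s * b r)"
    by simp
  also have "\<dots> = (\<Sum>i\<in>{1..<k}. a i * b (k - i))"
    by (subst sum.reindex) (auto simp: inj_on_def)
  finally show ?thesis by (simp add: w linear_form_def)
next
  case False
  then have "letter s w = 0" for s by (auto simp: letter_def)
  then have "(\<Sum>\<^sub>\<infinity>(r, s)\<in>{1..} \<times> {1..}. a s * b r * letter (s + r) w) = 0"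
    by (intro infsum_0) auto
  then show ?thesis using False by (auto simp: linear_form_def split: list.splits)
qed

text \<open>In positive degree these are the coefficients of the product of two power series with
  constant term 1; the sum over i collects the cross terms.\<close>

definition stuffle_coeff :: "(nat \<Rightarrow> complex) \<Rightarrow> (nat \<Rightarrow> complex) \<Rightarrow> nat \<Rightarrow> complex" where
  "stuffle_coeff a b k = a k + b k + (\<Sum>i\<in>{1..<k}. a i * b (k - i))"

lemma Abs_fps_stuffle_coeff:
  "Abs_fps ((stuffle_coeff a b)(0 := 1)) = Abs_fps (a(0 := 1)) * Abs_fps (b(0 := 1))"
proof (rule fps_ext)
  fix k
  show "fps_nth (Abs_fps ((stuffle_coeff a b)(0 := 1))) k =
      fps_nth (Abs_fps (a(0 := 1)) * Abs_fps (b(0 := 1))) k"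
  proof (cases k)
    case (Suc m)
    have "(\<Sum>i=0..k. (a(0 := 1)) i * (b(0 := 1)) (k - i)) =
        b k + (\<Sum>i\<in>{1..<k}. (a(0 := 1)) i * (b(0 := 1)) (k - i)) + a k"
      unfolding Suc by (simp add: sum.atLeast_Suc_atMost sum.nat_ivl_Suc' atLeastLessThanSuc_atLeastAtMost)
    also have "(\<Sum>i\<in>{1..<k}. (a(0 := 1)) i * (b(0 := 1)) (k - i)) = (\<Sum>i\<in>{1..<k}. a i * b (k - i))"
      by (intro sum.cong) auto
    finally show ?thesis
      using Suc by (simp add: fps_mult_nth stuffle_coeff_def)
  qed simp
qed

lemma H_series_stuffle:
  assumes "star_form a \<in> Dom_H" "star_form b \<in> Dom_H" "star_form (stuffle_coeff a b) \<in> Dom_H"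
  shows "H_series (star_form (stuffle_coeff a b)) N = H_series (star_form a) N * H_series (star_form b) N"
  by (rule H_series_star_mult[OF assms Abs_fps_stuffle_coeff])

lemma stuffle_coeff_single:
  assumes "r \<ge> 1" "s \<ge> 1"
  shows "stuffle_coeff (single s x) (single r y) =
    (\<lambda>k. single s x k + single r y k + single (s + r) (x * y) k)"
proof
  fix k
  have "(\<Sum>i\<in>{1..<k}. single s x i * single r y (k - i)) =
      (\<Sum>i\<in>{1..<k}. if i = s then x * single r y (k - s) else 0)"
    by (intro sum.cong) (auto simp: single_def)
  also have "\<dots> = single (s + r) (x * y) k"
    using assms by (auto simp: single_def)
  finally show "stuffle_coeff (single s x) (single r y) k =
      single s x k + single r y k + single (s + r) (x * y) k"
    by (simp add: stuffle_coeff_def)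
qed

lemma star_form_finite_support_in_Dom_H:
  assumes "finite {s. c s \<noteq> 0}" "c 0 = 0"
  shows "star_form c \<in> Dom_H"
proof (rule star_form_in_Dom_H[where M = "\<Sum>s\<in>{s. c s \<noteq> 0}. norm (c s)"])
  fix m
  have "(\<Sum>s=1..m. norm (c s)) = (\<Sum>s\<in>{1..m} \<inter> {s. c s \<noteq> 0}. norm (c s))"
    by (intro sum.mono_neutral_right) auto
  also have "\<dots> \<le> (\<Sum>s\<in>{s. c s \<noteq> 0}. norm (c s))"
    using assms(1) by (intro sum_mono2) auto
  finally show "(\<Sum>s=1..m. norm (c s)) \<le> (\<Sum>s\<in>{s. c s \<noteq> 0}. norm (c s))" .
qed (fact assms(2))

lemma star_form_single_in_Dom_H:
  assumes "r \<ge> 1"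
  shows "star_form (single r x) \<in> Dom_H"
  by (rule star_form_finite_support_in_Dom_H)
     (use assms in \<open>auto simp: single_def intro: finite_subset[of _ "{r}"]\<close>)

lemma star_form_stuffle_single_in_Dom_H:
  assumes "r \<ge> 1" "s \<ge> 1"
  shows "star_form (stuffle_coeff (single s x) (single r y)) \<in> Dom_H"
proof (rule star_form_finite_support_in_Dom_H)
  show "finite {k. stuffle_coeff (single s x) (single r y) k \<noteq> 0}"
    by (rule finite_subset[of _ "{s, r, s + r}"])
       (auto simp: stuffle_coeff_single[OF assms] single_def split: if_splits)
  show "stuffle_coeff (single s x) (single r y) 0 = 0"
    using assms by (simp add: stuffle_coeff_single[OF assms] single_def)
qed

subsection \<open>The star of a single letter\<close>

lemma star_form_single_nonzeroD:
  assumes "star_form (single r x) ss \<noteq> 0"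
  shows "ss = replicate (length ss) r" "sum_list ss = length ss * r"
proof -
  show ss: "ss = replicate (length ss) r"
    using assms
    by (intro replicate_length_same[symmetric])
       (auto simp: kleene_star_linear_form prod_list_zero_iff single_def)
  show "sum_list ss = length ss * r"
    by (subst ss) (simp add: sum_list_replicate)
qed

text \<open>Only the powers of y_r carry a coefficient, and the k-th one sits in weight k r. All
  other weights vanish, so the series over weights can be reindexed along the multiples of
  r.\<close>

lemma H_series_single_sums:
  assumes r: "r \<ge> 1"
  shows "(\<lambda>k. H_word (replicate k r) N * x ^ k) sums H_series (star_form (single r x)) N"
proof -
  have eq: "graded_H (star_form (single r x)) N (k * r) = H_word (replicate k r) N * x ^ k" for k
  proof -
    have "graded_H (star_form (single r x)) N (k * r) =
        (\<Sum>ss\<in>{replicate k r}. star_form (single r x) ss * H_word ss N)"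
      unfolding graded_H_def
    proof (rule sum.mono_neutral_right)
      show "{replicate k r} \<subseteq> weight_words (k * r)"
        using r by (auto simp: weight_words_def Y_words_def sum_list_replicate)
      show "\<forall>ss\<in>weight_words (k * r) - {replicate k r}. star_form (single r x) ss * H_word ss N = 0"
      proof
        fix ss assume ss: "ss \<in> weight_words (k * r) - {replicate k r}"
        have "star_form (single r x) ss = 0"
        proof (rule ccontr)
          assume "star_form (single r x) ss \<noteq> 0"
          note D = star_form_single_nonzeroD[OF this]
          have "length ss = k" using D(2) ss r by (simp add: weight_words_def)
          then show False using D(1) ss by simp
        qed
        then show "star_form (single r x) ss * H_word ss N = 0" by simp
      qed
    qed simp
    then show ?thesis
      by (simp add: kleene_star_linear_form single_def map_replicate_const prod_list_replicate)
  qed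
  have "graded_H (star_form (single r x)) N n = 0" if n: "n \<notin> range (\<lambda>k. k * r)" for n
    unfolding graded_H_def
  proof (rule sum.neutral, rule ballI)
    fix ss assume ss: "ss \<in> weight_words n"
    have "star_form (single r x) ss = 0"
    proof (rule ccontr)
      assume "star_form (single r x) ss \<noteq> 0"
      then have "sum_list ss = length ss * r" by (rule star_form_single_nonzeroD)
      then have "n = length ss * r" using ss by (simp add: weight_words_def)
      then show False using n by blast
    qed
    then show "star_form (single r x) ss * H_word ss N = 0" by simp
  qed
  then have "(\<lambda>k. graded_H (star_form (single r x)) N (k * r)) sums H_series (star_form (single r x)) N"
    using H_series_sums[OF star_form_single_in_Dom_H[OF r]] r
    by (subst sums_mono_reindex) (auto simp: strict_mono_def)
  then show ?thesis unfolding eq .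
qed

text \<open>The harmonic sum of the k-th power of y_r is the k-th elementary symmetric function of
  the numbers 1/j^r with j \<le> N. It is 0 for k > N, and the product is its generating
  polynomial.\<close>

lemma H_word_replicate_sums:
  "(\<lambda>k. H_word (replicate k r) N * x ^ k) sums (\<Prod>j=1..N. 1 + x / of_nat j ^ r)"
proof (induction N)
  case 0
  have "(\<lambda>k. H_word (replicate k r) 0 * x ^ k) = (\<lambda>k. if k = 0 then 1 else 0)"
    by (auto simp: fun_eq_iff gr0_conv_Suc)
  then show ?case using sums_single[of 0 "\<lambda>_. 1 :: complex"] by simp
next
  case (Suc N)
  define f where "f = (\<lambda>N k. H_word (replicate k r) N * x ^ k)"
  define y where "y = x / of_nat (Suc N) ^ r"
  have IH: "f N sums (\<Prod>j=1..N. 1 + x / of_nat j ^ r)"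
    using Suc.IH by (simp add: f_def)
  \<comment> \<open>Shifting the sequence by one place accounts for the words whose largest index is
    N + 1, each with the new factor y.\<close>
  have "(\<lambda>k. case k of 0 \<Rightarrow> 0 | Suc k \<Rightarrow> y * f N k) sums (y * (\<Prod>j=1..N. 1 + x / of_nat j ^ r))"
    using sums_Suc[where f = "\<lambda>k. case k of 0 \<Rightarrow> 0 | Suc k \<Rightarrow> y * f N k"] sums_mult[OF IH, of y]
    by simp
  from sums_add[OF IH this]
  have "(\<lambda>k. f N k + (case k of 0 \<Rightarrow> 0 | Suc k \<Rightarrow> y * f N k)) sums
      ((1 + y) * (\<Prod>j=1..N. 1 + x / of_nat j ^ r))"
    by (simp add: distrib_right)
  also have "(\<lambda>k. f N k + (case k of 0 \<Rightarrow> 0 | Suc k \<Rightarrow> y * f N k)) = f (Suc N)"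
    by (auto simp: fun_eq_iff f_def y_def H_word_Cons_Suc field_simps split: nat.splits simp del: of_nat_Suc)
  finally show ?case by (simp add: f_def y_def mult.commute)
qed

text \<open>The sums for the letters y_{kr} are the power sums of the numbers 1/j^r, so this is the
  passage from power sums to elementary symmetric functions. Logarithms are taken of the single
  factors, all within distance 1 of the point 1; the exponential of their sum is the product, and no
  branch for the logarithm of the product has to be chosen.\<close>

lemma H_word_exp_sums:
  assumes "norm x < 1"
  obtains l where "(\<lambda>k. H_word [Suc k * r] N * (- x) ^ Suc k / of_nat (Suc k)) sums l"
    "exp (- l) = (\<Prod>j=1..N. 1 + x / of_nat j ^ r)"
proof
  have nx: "norm (x / of_nat j ^ r) < 1" if "j \<in> {1..N}" for j
  proof -
    have "1 \<le> real j ^ r" using that by (intro one_le_power) auto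
    then have "norm x < real j ^ r" using assms by linarith
    moreover have "real j ^ r > 0" using that by simp
    ultimately show ?thesis by (simp add: norm_divide norm_power)
  qed
  have "(\<lambda>k. (- (x / of_nat j ^ r)) ^ Suc k / of_nat (Suc k)) sums (- ln (1 + x / of_nat j ^ r))"
    if "j \<in> {1..N}" for j
  proof -
    define z where "z = x / of_nat j ^ r"
    have "(\<lambda>n. (-1) ^ Suc n / of_nat n * z ^ n) sums ln (1 + z)"
      using nx[OF that] unfolding z_def by (rule Ln_series)
    \<comment> \<open>The shift loses nothing: the term n = 0 is 0, since division by 0 gives
      0.\<close>
    then have "(\<lambda>n. (-1) ^ Suc (Suc n) / of_nat (Suc n) * z ^ Suc n) sums ln (1 + z)"
      by (subst sums_Suc_iff) simp
    then have "(\<lambda>n. - ((-1) ^ Suc (Suc n) / of_nat (Suc n) * z ^ Suc n)) sums (- ln (1 + z))"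
      by (rule sums_minus)
    also have "(\<lambda>n. - ((-1) ^ Suc (Suc n) / of_nat (Suc n) * z ^ Suc n)) =
        (\<lambda>n. (- z) ^ Suc n / of_nat (Suc n))"
      by (simp add: fun_eq_iff power_minus[of z] del: of_nat_Suc)
    finally show ?thesis by (simp only: z_def)
  qed
  then have "(\<lambda>k. \<Sum>j=1..N. (- (x / of_nat j ^ r)) ^ Suc k / of_nat (Suc k)) sums
      (\<Sum>j=1..N. - ln (1 + x / of_nat j ^ r))"
    by (intro sums_sum)
  also have "(\<lambda>k. \<Sum>j=1..N. (- (x / of_nat j ^ r)) ^ Suc k / of_nat (Suc k)) =
      (\<lambda>k. H_word [Suc k * r] N * (- x) ^ Suc k / of_nat (Suc k))"
  proof
    fix k
    have "(- (x / of_nat j ^ r)) ^ Suc k = 1 / of_nat j ^ (Suc k * r) * (- x) ^ Suc k" for j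
      unfolding minus_divide_left power_divide power_mult[symmetric] mult.commute[of r] by simp
    then show "(\<Sum>j=1..N. (- (x / of_nat j ^ r)) ^ Suc k / of_nat (Suc k)) =
        H_word [Suc k * r] N * (- x) ^ Suc k / of_nat (Suc k)"
      by (simp only: H_word_Cons H_word_Nil mult_1_right sum_distrib_right sum_divide_distrib)
  qed
  finally show "(\<lambda>k. H_word [Suc k * r] N * (- x) ^ Suc k / of_nat (Suc k)) sums
      (\<Sum>j=1..N. - ln (1 + x / of_nat j ^ r))" .
  have "exp (- (\<Sum>j=1..N. - ln (1 + x / of_nat j ^ r))) = (\<Prod>j=1..N. exp (ln (1 + x / of_nat j ^ r)))"
    by (simp add: sum_negf exp_sum)
  also have "\<dots> = (\<Prod>j=1..N. 1 + x / of_nat j ^ r)"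
  proof (intro prod.cong refl exp_Ln)
    fix j assume "j \<in> {1..N}"
    from nx[OF this] show "1 + x / of_nat j ^ r \<noteq> 0"
      by (metis add_eq_0_iff norm_minus_cancel norm_one less_irrefl)
  qed
  finally show "exp (- (\<Sum>j=1..N. - ln (1 + x / of_nat j ^ r))) = (\<Prod>j=1..N. 1 + x / of_nat j ^ r)" .
qed

lemma H_series_single:
  assumes "r \<ge> 1" "norm t < 1"
  defines "S \<equiv> star_form (single r (t ^ r))"
  shows "S \<in> Dom_H"
    and "(\<lambda>k. H_word (replicate k r) N * t ^ (k * r)) sums H_series S N"
    and "summable (\<lambda>k. H_word [Suc k * r] N * (- (t ^ r)) ^ Suc k / of_nat (Suc k))"
    and "H_series S N = exp (- (\<Sum>k. H_word [Suc k * r] N * (- (t ^ r)) ^ Suc k / of_nat (Suc k)))"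
proof -
  show "S \<in> Dom_H"
    unfolding S_def by (rule star_form_single_in_Dom_H[OF assms(1)])
  have pow: "(t ^ r) ^ k = t ^ (k * r)" for k
    by (simp add: mult.commute flip: power_mult)
  have sums: "(\<lambda>k. H_word (replicate k r) N * (t ^ r) ^ k) sums H_series S N"
    unfolding S_def by (rule H_series_single_sums[OF assms(1)])
  then show "(\<lambda>k. H_word (replicate k r) N * t ^ (k * r)) sums H_series S N"
    unfolding pow .
  have "norm t ^ r \<le> norm t ^ 1"
    using assms by (intro power_decreasing) auto
  then have "norm (t ^ r) < 1"
    using assms(2) by (simp add: norm_power)
  then obtain l where l: "(\<lambda>k. H_word [Suc k * r] N * (- (t ^ r)) ^ Suc k / of_nat (Suc k)) sums l"
    "exp (- l) = (\<Prod>j=1..N. 1 + t ^ r / of_nat j ^ r)"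
    by (rule H_word_exp_sums)
  from l(1) show "summable (\<lambda>k. H_word [Suc k * r] N * (- (t ^ r)) ^ Suc k / of_nat (Suc k))"
    by (rule sums_summable)
  have "H_series S N = exp (- l)"
    unfolding l(2) by (rule sums_unique2[OF sums H_word_replicate_sums])
  then show "H_series S N = exp (- (\<Sum>k. H_word [Suc k * r] N * (- (t ^ r)) ^ Suc k / of_nat (Suc k)))"
    by (simp only: sums_unique[OF l(1), symmetric])
qed

section \<open>Identities for stars of one and two letters\<close>

lemma kleene_star_letter_in_Dom_H:
  "r \<ge> 1 \<Longrightarrow> kleene_star (\<lambda>w. x * letter r w) \<in> Dom_H"
  using star_form_single_in_Dom_H[of r x] by (simp only: linear_form_single)

lemma H_series_two_letters:
  fixes x y :: complex
  assumes "r \<ge> 1" "s \<ge> 1"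
  defines "C \<equiv> kleene_star (\<lambda>w. x * letter s w + y * letter r w + x * y * letter (s + r) w)"
  shows "C \<in> Dom_H"
    and "H_series C N =
      H_series (kleene_star (\<lambda>w. x * letter s w)) N * H_series (kleene_star (\<lambda>w. y * letter r w)) N"
proof -
  have C: "C = star_form (stuffle_coeff (single s x) (single r y))"
    by (simp only: C_def stuffle_coeff_single[OF assms(1,2)] linear_form_add linear_form_single)
  show "C \<in> Dom_H"
    unfolding C by (rule star_form_stuffle_single_in_Dom_H[OF assms(1,2)])
  then show "H_series C N =
      H_series (kleene_star (\<lambda>w. x * letter s w)) N * H_series (kleene_star (\<lambda>w. y * letter r w)) N"
    unfolding C linear_form_single[symmetric]
    by (intro H_series_stuffle star_form_single_in_Dom_H assms)
qed

text \<open>The two-letter formula with equal letters and opposite coefficients: the linear terms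
  cancel and only the cross term remains.\<close>

lemma H_series_letter_neg:
  fixes x :: complex
  assumes "s \<ge> 1"
  defines "C \<equiv> kleene_star (\<lambda>w. - (x\<^sup>2) * letter (2 * s) w)"
  shows "C \<in> Dom_H"
    and "H_series C N =
      H_series (kleene_star (\<lambda>w. x * letter s w)) N * H_series (kleene_star (\<lambda>w. - x * letter s w)) N"
proof -
  have "C = kleene_star (\<lambda>w. x * letter s w + - x * letter s w + x * - x * letter (s + s) w)"
    by (simp add: C_def power2_eq_square mult_2)
  with H_series_two_letters[OF assms(1,1), of x "- x"]
  show "C \<in> Dom_H" "H_series C N =
      H_series (kleene_star (\<lambda>w. x * letter s w)) N * H_series (kleene_star (\<lambda>w. - x * letter s w)) N"
    by simp_all
qed

theorem theorem2p18:
  "(\<forall>(r::nat) (t::complex). 1 \<le> r \<and> norm t < 1 \<longrightarrow>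
      (let S = kleene_star (\<lambda>w. t ^ r * letter r w) in
         S \<in> Dom_H \<and>
         (\<forall>N. (\<lambda>k. H_word (replicate k r) N * t ^ (k * r)) sums H_series S N \<and>
              summable (\<lambda>k. H_word [Suc k * r] N * (- (t ^ r)) ^ Suc k / of_nat (Suc k)) \<and>
              H_series S N =
                exp (- (\<Sum>k. H_word [Suc k * r] N * (- (t ^ r)) ^ Suc k / of_nat (Suc k)))))) \<and>
   (\<forall>(a :: nat \<Rightarrow> complex) (b :: nat \<Rightarrow> complex).
      (\<forall>s\<ge>1. norm (a s) < 1 \<and> norm (b s) < 1 \<and> norm (a s + b s) < 1) \<longrightarrow>
      (let A = kleene_star (\<lambda>w. \<Sum>\<^sub>\<infinity>s\<in>{1..}. a s * letter s w);
           B = kleene_star (\<lambda>w. \<Sum>\<^sub>\<infinity>s\<in>{1..}. b s * letter s w);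
           C = kleene_star (\<lambda>w. (\<Sum>\<^sub>\<infinity>s\<in>{1..}. (a s + b s) * letter s w) +
                 (\<Sum>\<^sub>\<infinity>(r, s)\<in>{1..} \<times> {1..}. a s * b r * letter (s + r) w))
       in A \<in> Dom_H \<and> B \<in> Dom_H \<and> C \<in> Dom_H \<longrightarrow>
          (\<forall>N. H_series C N = H_series A N * H_series B N))) \<and>
   (\<forall>a :: nat \<Rightarrow> complex. (\<forall>s\<ge>1. norm (a s) < 1) \<longrightarrow>
      (\<forall>r\<ge>1. \<forall>s\<ge>1.
        (let S = kleene_star (\<lambda>w. a s * letter s w);
             R = kleene_star (\<lambda>w. a r * letter r w);
             C = kleene_star (\<lambda>w. a s * letter s w + a r * letter r w
                   + a s * a r * letter (s + r) w)
         in S \<in> Dom_H \<and> R \<in> Dom_H \<and> C \<in> Dom_H \<and>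
            (\<forall>N. H_series C N = H_series S N * H_series R N))) \<and>
      (\<forall>s\<ge>1.
        (let P = kleene_star (\<lambda>w. a s * letter s w);
             M = kleene_star (\<lambda>w. - a s * letter s w);
             C = kleene_star (\<lambda>w. - ((a s)\<^sup>2) * letter (2 * s) w)
         in P \<in> Dom_H \<and> M \<in> Dom_H \<and> C \<in> Dom_H \<and>
            (\<forall>N. H_series C N = H_series P N * H_series M N))))"
proof (intro conjI)
  show "\<forall>(r::nat) (t::complex). 1 \<le> r \<and> norm t < 1 \<longrightarrow>
      (let S = kleene_star (\<lambda>w. t ^ r * letter r w) in
         S \<in> Dom_H \<and>
         (\<forall>N. (\<lambda>k. H_word (replicate k r) N * t ^ (k * r)) sums H_series S N \<and>
              summable (\<lambda>k. H_word [Suc k * r] N * (- (t ^ r)) ^ Suc k / of_nat (Suc k)) \<and>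
              H_series S N =
                exp (- (\<Sum>k. H_word [Suc k * r] N * (- (t ^ r)) ^ Suc k / of_nat (Suc k)))))"
    unfolding linear_form_single[symmetric] Let_def using H_series_single by blast
next
  \<comment> \<open>The families are constrained only from index 1 on, so their values at 0 are
    reset to 0. The convolution over {1..<k} never reads them, as both i and k - i are positive
    there.\<close>
  have C: "(\<lambda>w. (\<Sum>\<^sub>\<infinity>s\<in>{1..}. (a s + b s) * letter s w) +
      (\<Sum>\<^sub>\<infinity>(r, s)\<in>{1..} \<times> {1..}. a s * b r * letter (s + r) w)) =
      linear_form (stuffle_coeff (a(0 := 0)) (b(0 := 0)))" for a b :: "nat \<Rightarrow> complex"
  proof -
    have "(\<lambda>w. (\<Sum>\<^sub>\<infinity>s\<in>{1..}. (a s + b s) * letter s w) +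
        (\<Sum>\<^sub>\<infinity>(r, s)\<in>{1..} \<times> {1..}. a s * b r * letter (s + r) w)) =
        linear_form (\<lambda>k. ((\<lambda>s. a s + b s)(0 := 0)) k + (\<Sum>i\<in>{1..<k}. a i * b (k - i)))"
      by (simp only: linear_form_add infsum_letter infsum_letter_add)
    also have "(\<lambda>k. ((\<lambda>s. a s + b s)(0 := 0)) k + (\<Sum>i\<in>{1..<k}. a i * b (k - i))) =
        stuffle_coeff (a(0 := 0)) (b(0 := 0))"
      by (auto simp: fun_eq_iff stuffle_coeff_def intro!: sum.cong)
    finally show ?thesis .
  qed
  show "\<forall>(a :: nat \<Rightarrow> complex) (b :: nat \<Rightarrow> complex).
      (\<forall>s\<ge>1. norm (a s) < 1 \<and> norm (b s) < 1 \<and> norm (a s + b s) < 1) \<longrightarrow>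
      (let A = kleene_star (\<lambda>w. \<Sum>\<^sub>\<infinity>s\<in>{1..}. a s * letter s w);
           B = kleene_star (\<lambda>w. \<Sum>\<^sub>\<infinity>s\<in>{1..}. b s * letter s w);
           C = kleene_star (\<lambda>w. (\<Sum>\<^sub>\<infinity>s\<in>{1..}. (a s + b s) * letter s w) +
                 (\<Sum>\<^sub>\<infinity>(r, s)\<in>{1..} \<times> {1..}. a s * b r * letter (s + r) w))
       in A \<in> Dom_H \<and> B \<in> Dom_H \<and> C \<in> Dom_H \<longrightarrow>
          (\<forall>N. H_series C N = H_series A N * H_series B N))"
    unfolding Let_def C unfolding infsum_letter by (intro allI impI H_series_stuffle) auto
next
  show "\<forall>a :: nat \<Rightarrow> complex. (\<forall>s\<ge>1. norm (a s) < 1) \<longrightarrow>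
      (\<forall>r\<ge>1. \<forall>s\<ge>1.
        (let S = kleene_star (\<lambda>w. a s * letter s w);
             R = kleene_star (\<lambda>w. a r * letter r w);
             C = kleene_star (\<lambda>w. a s * letter s w + a r * letter r w
                   + a s * a r * letter (s + r) w)
         in S \<in> Dom_H \<and> R \<in> Dom_H \<and> C \<in> Dom_H \<and>
            (\<forall>N. H_series C N = H_series S N * H_series R N))) \<and>
      (\<forall>s\<ge>1.
        (let P = kleene_star (\<lambda>w. a s * letter s w);
             M = kleene_star (\<lambda>w. - a s * letter s w);
             C = kleene_star (\<lambda>w. - ((a s)\<^sup>2) * letter (2 * s) w)
         in P \<in> Dom_H \<and> M \<in> Dom_H \<and> C \<in> Dom_H \<and>
            (\<forall>N. H_series C N = H_series P N * H_series M N)))"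
    unfolding Let_def
    by (intro allI impI conjI kleene_star_letter_in_Dom_H H_series_two_letters H_series_letter_neg) auto
qed

end
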